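(* Let $\mathcal{A}$ be a unital $C^*$-algebra and let $F\in B^a(H_{\mathcal{A}})$. Then $$\sigma_{e\tilde a}^{\mathcal{A}}(F)=\bigcap\{\,\sigma_a^{\mathcal{A}}(PF_{|R(P)}) \mid P\in \mathrm{P}^a(H_{\mathcal{A}})\,\},$$ where $\sigma_{e\tilde a}^{\mathcal{A}}(F)=\{\alpha\in Z(\mathcal{A}) \mid F-\alpha I\notin\widehat{\mathcal{M}\Phi}_+^-(H_{\mathcal{A}})\}$ and, for $P\in \mathrm{P}^a(H_{\mathcal{A}})$, $\sigma_a^{\mathcal{A}}(PF_{|R(P)})$ is the set of all $\alpha\in Z(\mathcal{A})$ such that $(PF-\alpha I)_{|R(P)}$ is not bounded below on $R(P)$.
   Context: $\mathcal{A}$ is a unital $C^*$-algebra with center $Z(\mathcal{A})$; $H_{\mathcal{A}}$ is the standard countably generated (right) Hilbert $\mathcal{A}$-module. $B^a(H_{\mathcal{A}})$ is the set of bounded adjointable operators on $H_{\mathcal{A}}$. For $\alpha\in Z(\mathcal{A})$, $\alpha I$ is the operator $x\mapsto x\alpha$ (it maps $R(P)$ into $R(P)$ for every $\mathcal{A}$-linear idempotent $P$). $R(T)$ and $N(T)$ denote image and kernel of $T$. $\tilde\oplus$ denotes the internal direct sum of closed submodules, not necessarily orthogonal. A Hilbert module is finitely generated if it equals the $\mathcal{A}$-linear span of a finite subset. "Isomorphism" (and $\cong$) between closed submodules means a bounded bijective $\mathcal{A}$-linear map (with bounded inverse). "Projection" means a not necessarily orthogonal (skew) projection, i.e. an idempotent.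 $\mathrm{P}^a(H_{\mathcal{A}})=\{P\in B^a(H_{\mathcal{A}}) \mid P \text{ is a projection and } N(P) \text{ is finitely generated}\}$. "$F$ has matrix $\begin{bmatrix}F_1&0\\0&F_4\end{bmatrix}$ with respect to the decomposition $H_{\mathcal{A}}=M_1\tilde\oplus N_1\stackrel{F}{\longrightarrow}M_2\tilde\oplus N_2=H_{\mathcal{A}}$" means that $F(M_1)\subseteq M_2$, $F(N_1)\subseteq N_2$, $F_1=F_{|M_1}:M_1\to M_2$ and $F_4=F_{|N_1}:N_1\to N_2$; here all four submodules are closed. $\widehat{\mathcal{M}\Phi}_+^-(H_{\mathcal{A}})$ is the set of all $F\in B^a(H_{\mathcal{A}})$ for which there is a decomposition $H_{\mathcal{A}}=M_1\tilde\oplus N_1\stackrel{F}{\longrightarrow}M_2\tilde\oplus N_2=H_{\mathcal{A}}$ with respect to which $F$ has matrix $\begin{bmatrix}F_1&0\\0&F_4\end{bmatrix}$, where $F_1$ is an isomorphism, $N_1$ is finitely generated, and there exist closed submodules $N_2',N$ such that $N_2'\subseteq N_2$, $N_2'\cong N_1$, $H_{\mathcal{A}}=N\tilde\oplus N_1=N\tilde\oplus N_2'$, and the projection onto $N$ along $N_2'$ is adjointable. *)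

theory Defs
  imports "HOL-Analysis.Analysis" "HOL-Library.Function_Algebras"
begin

text \<open>Unital C*-algebras. The unit comes from the class \<^class>\<open>monoid_mult\<close> rather than from
  \<^class>\<open>real_normed_algebra_1\<close>, because the latter would exclude the zero algebra.\<close>

class cstar_algebra = real_normed_algebra + banach + monoid_mult +
  fixes scaleC :: "complex \<Rightarrow> 'a \<Rightarrow> 'a"  (infixr "*\<^sub>C" 75)
    and star :: "'a \<Rightarrow> 'a"
  assumes scaleC_add_right: "c *\<^sub>C (x + y) = c *\<^sub>C x + c *\<^sub>C y"
    and scaleC_add_left: "(c + d) *\<^sub>C x = c *\<^sub>C x + d *\<^sub>C x"
    and scaleC_scaleC: "c *\<^sub>C d *\<^sub>C x = (c * d) *\<^sub>C x"
    and scaleR_scaleC: "r *\<^sub>R x = complex_of_real r *\<^sub>C x"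
    and mult_scaleC_left: "(c *\<^sub>C x) * y = c *\<^sub>C (x * y)"
    and mult_scaleC_right: "x * (c *\<^sub>C y) = c *\<^sub>C (x * y)"
    and norm_scaleC: "norm (c *\<^sub>C x) = cmod c * norm x"
    and star_add: "star (x + y) = star x + star y"
    and star_scaleC: "star (c *\<^sub>C x) = cnj c *\<^sub>C star x"
    and star_mult: "star (x * y) = star y * star x"
    and star_star: "star (star x) = x"
    and cstar_identity: "norm (star x * x) = (norm x)\<^sup>2"

definition center :: "'a::cstar_algebra set" where
  "center = {a. \<forall>b. a * b = b * a}"

text \<open>The standard module is the set of those sequences in the algebra for which the series of
  \<open>star (x n) * x n\<close> is norm convergent. Addition of sequences is pointwise (from
  \<^theory>\<open>HOL-Library.Function_Algebras\<close>); the algebra acts on the right. Complex scalars act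
  through multiples of the unit, so submodules and module maps need no separate clause for them.\<close>

definition HA :: "(nat \<Rightarrow> 'a::cstar_algebra) set" where
  "HA = {x. summable (\<lambda>n. star (x n) * x n)}"

definition rmult :: "(nat \<Rightarrow> 'a::cstar_algebra) \<Rightarrow> 'a \<Rightarrow> (nat \<Rightarrow> 'a)"  (infixl "\<cdot>\<^sub>A" 70) where
  "x \<cdot>\<^sub>A a = (\<lambda>n. x n * a)"

definition hinner :: "(nat \<Rightarrow> 'a::cstar_algebra) \<Rightarrow> (nat \<Rightarrow> 'a) \<Rightarrow> 'a" where
  "hinner x y = (\<Sum>n. star (x n) * y n)"

definition hnorm :: "(nat \<Rightarrow> 'a::cstar_algebra) \<Rightarrow> real" where
  "hnorm x = sqrt (norm (hinner x x))"

definition closed_submodule :: "(nat \<Rightarrow> 'a::cstar_algebra) set \<Rightarrow> bool" where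
  "closed_submodule M \<longleftrightarrow>
     M \<subseteq> HA \<and> 0 \<in> M \<and> (\<forall>x\<in>M. \<forall>y\<in>M. x + y \<in> M) \<and> (\<forall>x\<in>M. \<forall>a. x \<cdot>\<^sub>A a \<in> M) \<and>
     (\<forall>X. \<forall>x\<in>HA. (\<forall>k. X k \<in> M) \<and> (\<lambda>k. hnorm (X k - x)) \<longlonglongrightarrow> 0 \<longrightarrow> x \<in> M)"

definition decomposition ::
  "(nat \<Rightarrow> 'a::cstar_algebra) set \<Rightarrow> (nat \<Rightarrow> 'a) set \<Rightarrow> bool" where
  "decomposition M N \<longleftrightarrow>
     closed_submodule M \<and> closed_submodule N \<and> M \<inter> N = {0} \<and> HA = {x + y | x y. x \<in> M \<and> y \<in> N}"

definition finitely_generated :: "(nat \<Rightarrow> 'a::cstar_algebra) set \<Rightarrow> bool" where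
  "finitely_generated M \<longleftrightarrow>
     (\<exists>S. finite S \<and> S \<subseteq> M \<and> M = {\<Sum>s\<in>S. s \<cdot>\<^sub>A c s | c. True})"

text \<open>Operators are total HOL functions; only their values on the submodule in question matter.\<close>

definition A_linear_on ::
  "(nat \<Rightarrow> 'a::cstar_algebra) set \<Rightarrow> ((nat \<Rightarrow> 'a) \<Rightarrow> (nat \<Rightarrow> 'a)) \<Rightarrow> bool" where
  "A_linear_on M T \<longleftrightarrow>
     (\<forall>x\<in>M. \<forall>y\<in>M. T (x + y) = T x + T y) \<and> (\<forall>x\<in>M. \<forall>a. T (x \<cdot>\<^sub>A a) = T x \<cdot>\<^sub>A a)"

definition hbounded_on ::
  "(nat \<Rightarrow> 'a::cstar_algebra) set \<Rightarrow> ((nat \<Rightarrow> 'a) \<Rightarrow> (nat \<Rightarrow> 'a)) \<Rightarrow> bool" where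
  "hbounded_on M T \<longleftrightarrow> (\<exists>C. \<forall>x\<in>M. hnorm (T x) \<le> C * hnorm x)"

definition bounded_below_on ::
  "(nat \<Rightarrow> 'a::cstar_algebra) set \<Rightarrow> ((nat \<Rightarrow> 'a) \<Rightarrow> (nat \<Rightarrow> 'a)) \<Rightarrow> bool" where
  "bounded_below_on M T \<longleftrightarrow> (\<exists>c>0. \<forall>x\<in>M. c * hnorm x \<le> hnorm (T x))"

definition Ba :: "((nat \<Rightarrow> 'a::cstar_algebra) \<Rightarrow> (nat \<Rightarrow> 'a)) set" where
  "Ba = {T. T ` HA \<subseteq> HA \<and> A_linear_on HA T \<and> hbounded_on HA T \<and>
           (\<exists>S. S ` HA \<subseteq> HA \<and> (\<forall>x\<in>HA. \<forall>y\<in>HA. hinner (T x) y = hinner x (S y)))}"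

definition is_iso ::
  "(nat \<Rightarrow> 'a::cstar_algebra) set \<Rightarrow> (nat \<Rightarrow> 'a) set \<Rightarrow> ((nat \<Rightarrow> 'a) \<Rightarrow> (nat \<Rightarrow> 'a)) \<Rightarrow> bool" where
  "is_iso M N T \<longleftrightarrow>
     bij_betw T M N \<and> A_linear_on M T \<and> hbounded_on M T \<and> hbounded_on N (inv_into M T)"

definition isomorphic ::
  "(nat \<Rightarrow> 'a::cstar_algebra) set \<Rightarrow> (nat \<Rightarrow> 'a) set \<Rightarrow> bool"  (infix "\<cong>\<^sub>A" 50) where
  "M \<cong>\<^sub>A N \<longleftrightarrow> (\<exists>T. is_iso M N T)"

text \<open>The projection onto \<open>M\<close> along \<open>N\<close>; meaningful only when \<open>decomposition M N\<close> holds.\<close>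

definition proj_along ::
  "(nat \<Rightarrow> 'a::cstar_algebra) set \<Rightarrow> (nat \<Rightarrow> 'a) set \<Rightarrow> (nat \<Rightarrow> 'a) \<Rightarrow> (nat \<Rightarrow> 'a)" where
  "proj_along M N x = (THE y. y \<in> M \<and> (\<exists>z\<in>N. x = y + z))"

definition range_of ::
  "((nat \<Rightarrow> 'a::cstar_algebra) \<Rightarrow> (nat \<Rightarrow> 'a)) \<Rightarrow> (nat \<Rightarrow> 'a) set" where
  "range_of T = T ` HA"

definition kernel_of ::
  "((nat \<Rightarrow> 'a::cstar_algebra) \<Rightarrow> (nat \<Rightarrow> 'a)) \<Rightarrow> (nat \<Rightarrow> 'a) set" where
  "kernel_of T = {x \<in> HA. T x = 0}"

definition Pa :: "((nat \<Rightarrow> 'a::cstar_algebra) \<Rightarrow> (nat \<Rightarrow> 'a)) set" where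
  "Pa = {P \<in> Ba. (\<forall>x\<in>HA. P (P x) = P x) \<and> finitely_generated (kernel_of P)}"

text \<open>The class of operators written \<open>M\<Phi>\<close> with a hat, subscript \<open>+\<close> and superscript \<open>-\<close>.\<close>

definition MPhi_hat_plus_minus :: "((nat \<Rightarrow> 'a::cstar_algebra) \<Rightarrow> (nat \<Rightarrow> 'a)) set" where
  "MPhi_hat_plus_minus = {F \<in> Ba. \<exists>M1 N1 M2 N2.
     decomposition M1 N1 \<and> decomposition M2 N2 \<and>
     F ` M1 \<subseteq> M2 \<and> F ` N1 \<subseteq> N2 \<and>
     is_iso M1 M2 F \<and> finitely_generated N1 \<and>
     (\<exists>N2' N. closed_submodule N2' \<and> closed_submodule N \<and>
        N2' \<subseteq> N2 \<and> N2' \<cong>\<^sub>A N1 \<and> decomposition N N1 \<and> decomposition N N2' \<and>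
        proj_along N N2' \<in> Ba)}"

definition sigma_ea ::
  "((nat \<Rightarrow> 'a::cstar_algebra) \<Rightarrow> (nat \<Rightarrow> 'a)) \<Rightarrow> 'a set" where
  "sigma_ea F = {\<alpha> \<in> center. (\<lambda>x. F x - x \<cdot>\<^sub>A \<alpha>) \<notin> MPhi_hat_plus_minus}"

text \<open>The approximate point spectrum of the restriction of \<open>T\<close> to \<open>M\<close>.\<close>

definition sigma_a ::
  "(nat \<Rightarrow> 'a::cstar_algebra) set \<Rightarrow> ((nat \<Rightarrow> 'a) \<Rightarrow> (nat \<Rightarrow> 'a)) \<Rightarrow> 'a set" where
  "sigma_a M T = {\<alpha> \<in> center. \<not> bounded_below_on M (\<lambda>x. T x - x \<cdot>\<^sub>A \<alpha>)}"

end

theory Submission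
  imports Defs
begin

text \<open>For a central \<open>\<alpha>\<close> put \<open>G x = F x - x \<cdot>\<^sub>A \<alpha>\<close>. As \<open>\<alpha>\<close> is central, \<open>G\<close> is again adjointable, and for \<open>x\<close>
in the range of an idempotent module map \<open>P\<close> the vector \<open>P (F x) - x \<cdot>\<^sub>A \<alpha>\<close> is \<open>P (G x)\<close>. So the theorem
says that an adjointable \<open>G\<close> belongs to \<open>MPhi_hat_plus_minus\<close> iff \<open>P \<circ> G\<close> is bounded below on the
range of some \<open>P \<in> Pa\<close>.

From the class to a projection (\<open>MPhi_hat_imp_bounded_below\<close>): let \<open>P\<close> be the projection onto \<open>N\<close>
along \<open>N2'\<close>. Since \<open>N2' \<subseteq> N2\<close>, the projection onto \<open>M2\<close> along \<open>N2\<close> takes \<open>P (G x)\<close> and \<open>G x\<close> to the same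
vector, namely \<open>G m\<close>, where \<open>x = m + n\<close> with \<open>m \<in> M1\<close> and \<open>n \<in> N1\<close>. Now \<open>G m\<close> controls \<open>m\<close>, because \<open>G\<close> is
an isomorphism on \<open>M1\<close>, and \<open>m\<close> controls \<open>x\<close>, because \<open>x\<close> is the projection of \<open>m\<close> onto \<open>N\<close> along \<open>N1\<close>.
All that is needed is that projections belonging to decompositions into closed submodules are
bounded (\<open>decomposition_bounded\<close>), a consequence of Baire's theorem.

From a projection to the class (\<open>bounded_below_imp_MPhi_hat\<close>): the operator \<open>P G P + (1 - P)\<close> is
adjointable and bounded below on the whole module, so it has a bounded left inverse \<open>L\<close>
(\<open>bounded_below_left_inverse\<close>). Then \<open>E = P L P\<close> vanishes on the kernel of \<open>P\<close> and satisfies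
\<open>E (G x) = x\<close> on the range of \<open>P\<close>. Hence \<open>E G\<close> and \<open>G E\<close> are idempotents, and \<open>G\<close> is diagonal from
\<open>range P \<oplus> kernel (E G)\<close> to \<open>range (G E) \<oplus> kernel (G E)\<close>. The kernel of \<open>P\<close> lies in \<open>kernel (G E)\<close>, and it
is isomorphic to \<open>kernel (E G)\<close>, because both complement the range of \<open>P\<close>.

The left inverse is the place where the \<open>C*\<close>-structure enters. Closed submodules
of a Hilbert module may fail to be complemented, so a left inverse of a bounded below \<open>T\<close> cannot be had from
closedness of its range as in a Hilbert space; it comes from the adjoint. The operator \<open>B = T\<^sup>* T\<close> is
bounded below, and by positivity of \<open>\<langle>x, B x\<rangle> = \<langle>T x, T x\<rangle>\<close> so is every \<open>B + t\<close> with \<open>t \<ge> 0\<close>, with the same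
constant. For large \<open>t\<close> the operator \<open>B + t\<close> is invertible, and invertibility propagates down to
\<open>t = 0\<close> in steps of fixed length (\<open>surj_of_bounded_below_translates\<close>). The left inverse is \<open>B\<^sup>-\<^sup>1 T\<^sup>*\<close>.

Even the norm of the standard module (its triangle inequality, its completeness) rests on the fact that
\<open>star x * x\<close> is positive and that the norm is monotone on positive elements. These are proved from the
axioms in the first part, without spectral theory: the only functions of an element that are used are its
polynomials and the square root, which is a limit of polynomials.\<close>

section \<open>Positive elements of a \<open>C*\<close>-algebra\<close>

lemma one_scaleC: "1 *\<^sub>C x = (x::'a::cstar_algebra)"
  using scaleR_scaleC[of 1 x] by simp

lemma minus_one_scaleC: "-1 *\<^sub>C x = - (x::'a::cstar_algebra)"
  using scaleR_scaleC[of "-1" x] by simp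

lemma minus_scaleC: "(- c) *\<^sub>C x = - (c *\<^sub>C (x::'a::cstar_algebra))"
  by (metis minus_one_scaleC mult_minus1 scaleC_scaleC)

lemma scaleC_minus: "c *\<^sub>C (- x) = - (c *\<^sub>C (x::'a::cstar_algebra))"
  by (metis minus_one_scaleC scaleC_scaleC mult.commute)

lemma scaleC_diff_right: "c *\<^sub>C (x - y) = c *\<^sub>C x - c *\<^sub>C (y::'a::cstar_algebra)"
  by (metis add_diff_cancel diff_add_cancel scaleC_add_right)

lemma star_zero [simp]: "star (0::'a::cstar_algebra) = 0"
  using star_add[of "0::'a" 0] by simp

lemma star_minus: "star (- x) = - star (x::'a::cstar_algebra)"
  using star_add[of x "- x"] by (simp add: eq_neg_iff_add_eq_0 add.commute)

lemma star_diff: "star (x - y) = star x - star (y::'a::cstar_algebra)"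
  using star_add[of x "- y"] by (simp add: star_minus)

lemma star_scaleR: "star (r *\<^sub>R x) = r *\<^sub>R star (x::'a::cstar_algebra)"
  by (simp add: scaleR_scaleC star_scaleC)

lemma star_one [simp]: "star (1::'a::cstar_algebra) = 1"
  using star_mult[of "star 1" "1::'a"] by (simp add: star_star)

lemma norm_star [simp]: "norm (star x) = norm (x::'a::cstar_algebra)"
proof -
  have le: "norm y \<le> norm (star y)" for y :: 'a
  proof (cases "y = 0")
    case False
    have "norm y * norm y \<le> norm (star y) * norm y"
      using norm_mult_ineq[of "star y" y] by (simp add: cstar_identity power2_eq_square)
    then show ?thesis using False by simp
  qed simp
  from le[of x] le[of "star x"] show ?thesis by (simp add: star_star)
qed

lemma bounded_linear_star: "bounded_linear (star :: 'a::cstar_algebra \<Rightarrow> 'a)"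
  by (rule bounded_linear_intro[where K = 1]) (simp_all add: star_add star_scaleR)

lemmas tendsto_star = bounded_linear.tendsto[OF bounded_linear_star]

lemma norm_self_adjoint_square: "star b = b \<Longrightarrow> norm (b * b) = (norm (b::'a::cstar_algebra))\<^sup>2"
  using cstar_identity[of b] by simp

lemma norm_one_le: "norm (1::'a::cstar_algebra) \<le> 1"
proof (rule ccontr)
  assume "\<not> ?thesis"
  moreover have "norm (1::'a) = (norm (1::'a))\<^sup>2"
    using norm_self_adjoint_square[of "1::'a"] by simp
  ultimately show False by (simp add: power2_eq_square)
qed

lemma norm_scaleR_one_le: "0 \<le> t \<Longrightarrow> norm (t *\<^sub>R (1::'a::cstar_algebra)) \<le> t"
  using norm_one_le[where 'a = 'a] by (simp add: mult_left_le)

text \<open>The element \<open>u = b + \<i> c\<close> has \<open>star u * u = b * b + c * c\<close>, and \<open>b\<close> is its real part. This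
monotonicity of the norm for commuting squares is the source of the norm estimates for positive elements
below.\<close>

lemma commuting_square_norm_le:
  fixes b c :: "'a::cstar_algebra"
  assumes "star b = b" "star c = c" "b * c = c * b"
  shows "(norm b)\<^sup>2 \<le> norm (b * b + c * c)"
proof -
  define u where "u = b + \<i> *\<^sub>C c"
  have su: "star u = b + (-\<i>) *\<^sub>C c"
    by (simp add: u_def star_add star_scaleC assms)
  have ii: "\<i> *\<^sub>C x + (-\<i>) *\<^sub>C x = 0" for x :: 'a
    using scaleC_add_left[of \<i> "-\<i>" x] scaleR_scaleC[of 0 x] by simp
  have "star u * u = b * b + \<i> *\<^sub>C (b * c) + ((-\<i>) *\<^sub>C (c * b) + c * c)"
    unfolding su
    by (simp add: u_def distrib_left distrib_right mult_scaleC_left mult_scaleC_right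
        scaleC_scaleC scaleC_add_right one_scaleC)
  also have "\<dots> = b * b + c * c + (\<i> *\<^sub>C (b * c) + (-\<i>) *\<^sub>C (b * c))"
    by (simp add: assms(3))
  finally have uu: "star u * u = b * b + c * c" by (simp add: ii)
  have "u + star u = b + b + (\<i> *\<^sub>C c + (-\<i>) *\<^sub>C c)"
    unfolding su by (simp add: u_def)
  then have "2 *\<^sub>R b = u + star u" by (simp add: ii scaleR_2)
  then have "2 * norm b \<le> norm u + norm (star u)"
    by (metis norm_triangle_ineq norm_scaleR abs_numeral)
  then have "norm b \<le> norm u" by simp
  then have "(norm b)\<^sup>2 \<le> (norm u)\<^sup>2" by simp
  then show ?thesis by (simp add: uu flip: cstar_identity)
qed

text \<open>If \<open>c = 1 - y\<close>, then \<open>c * c = 1 - h\<close> means \<open>y = (h + y * y) / 2\<close>. The fixed point iteration from 0 consists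
of polynomials in \<open>h\<close>, and its increments are dominated by those of the same iteration for the
number 1, which increases and is bounded by 1. The bound on \<open>1 - c\<close> makes \<open>c\<close> positive, and being a limit
of polynomials it commutes with whatever commutes with \<open>h\<close>.\<close>

lemma sqrt_one_minus:
  fixes h :: "'a::cstar_algebra"
  assumes sa: "star h = h" and h1: "norm h \<le> 1"
  obtains c where "star c = c" "c * c = 1 - h" "norm (1 - c) \<le> 1"
    "\<And>z. z * h = h * z \<Longrightarrow> z * c = c * z"
proof -
  define y where "y n = ((\<lambda>y. (1/2) *\<^sub>R (h + y * y)) ^^ n) 0" for n
  define t where "t n = ((\<lambda>t::real. (1 + t * t) / 2) ^^ n) 0" for n
  have y0: "y 0 = 0" and ySuc: "y (Suc n) = (1/2) *\<^sub>R (h + y n * y n)" for n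
    by (simp_all add: y_def)
  have t0: "t 0 = 0" and tSuc: "t (Suc n) = (1 + t n * t n) / 2" for n
    by (simp_all add: t_def)
  have t_nonneg: "0 \<le> t n" for n
    by (cases n) (simp_all add: t0 tSuc)
  have t_le1: "t n \<le> 1" for n
  proof (induction n)
    case (Suc n)
    have "t n * t n \<le> 1 * 1" using Suc t_nonneg[of n] by (intro mult_mono) auto
    then show ?case by (simp add: tSuc)
  qed (simp add: t0)
  have y_le: "norm (y n) \<le> t n" for n
  proof (induction n)
    case (Suc n)
    have "norm (y n * y n) \<le> t n * t n"
      using norm_mult_ineq[of "y n" "y n"] Suc
      by (meson mult_mono norm_ge_zero order_trans t_nonneg)
    then show ?case
      using norm_triangle_ineq[of h "y n * y n"] h1 by (simp add: ySuc tSuc)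
  qed (simp add: y0 t0)
  have comm: "z * y n = y n * z" if "z * h = h * z" for z n
  proof (induction n)
    case (Suc n)
    have "z * (y n * y n) = y n * y n * z" by (metis Suc mult.assoc)
    then show ?case by (simp add: ySuc distrib_left distrib_right that)
  qed (simp add: y0)
  have comm_y: "y m * y n = y n * y m" for m n
    by (rule comm) (rule comm[symmetric], rule refl)
  \<comment> \<open>Iterates commute, so consecutive squares differ by the product of sum and difference.\<close>
  have step: "norm (y (Suc n) - y n) \<le> t (Suc n) - t n" for n
  proof (induction n)
    case 0
    then show ?case using h1 by (simp add: y0 t0 ySuc tSuc)
  next
    case (Suc n)
    have "(y (Suc n) + y n) * (y (Suc n) - y n) = y (Suc n) * y (Suc n) - y n * y n"
      using comm_y[of n "Suc n"] by (simp add: distrib_left distrib_right right_diff_distrib left_diff_distrib)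
    with arg_cong2[OF ySuc[of "Suc n"] ySuc[of n], of minus]
    have eq: "y (Suc (Suc n)) - y (Suc n) = (1/2) *\<^sub>R ((y (Suc n) + y n) * (y (Suc n) - y n))"
      by (simp add: scaleR_diff_right scaleR_add_right)
    from arg_cong2[OF tSuc[of "Suc n"] tSuc[of n], of minus]
    have teq: "t (Suc (Suc n)) - t (Suc n) = (1/2) * ((t (Suc n) + t n) * (t (Suc n) - t n))"
      by (simp add: algebra_simps diff_divide_distrib add_divide_distrib)
    have "norm ((y (Suc n) + y n) * (y (Suc n) - y n)) \<le> (t (Suc n) + t n) * (t (Suc n) - t n)"
    proof (rule order_trans[OF norm_mult_ineq mult_mono])
      show "norm (y (Suc n) + y n) \<le> t (Suc n) + t n"
        using norm_triangle_ineq[of "y (Suc n)" "y n"] y_le[of n] y_le[of "Suc n"] by linarith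
    qed (use Suc t_nonneg[of n] t_nonneg[of "Suc n"] in auto)
    then show ?case unfolding eq teq by simp
  qed
  have t_mono: "t n \<le> t (Suc n)" for n
    using step[of n] norm_ge_zero[of "y (Suc n) - y n"] by linarith
  have "incseq t" by (rule incseq_SucI) (rule t_mono)
  then obtain T where "t \<longlonglongrightarrow> T"
    using incseq_convergent[of t 1] t_le1 by blast
  then have "summable (\<lambda>n. t (Suc n) - t n)"
    by (rule telescope_summable)
  then have "summable (\<lambda>n. norm (y (Suc n) - y n))"
    by (rule summable_comparison_test'[where N = 0]) (simp add: step)
  then have "summable (\<lambda>n. y (Suc n) - y n)" by (rule summable_norm_cancel)
  then have "(\<lambda>n. \<Sum>k<n. y (Suc k) - y k) \<longlonglongrightarrow> (\<Sum>n. y (Suc n) - y n)"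
    by (rule summable_LIMSEQ)
  then obtain l where l: "y \<longlonglongrightarrow> l"
    by (auto simp: sum_lessThan_telescope y0)
  have sy: "star (y n) = y n" for n
    by (induction n) (simp_all add: y0 ySuc star_add star_scaleR star_mult sa)
  have star_l: "star l = l"
    using tendsto_star[OF l] unfolding sy by (rule LIMSEQ_unique) (rule l)
  have norm_l: "norm l \<le> 1"
    by (rule Lim_bounded[OF tendsto_norm[OF l], of 0]) (meson order_trans t_le1 y_le)
  have "(\<lambda>n. y (Suc n)) \<longlonglongrightarrow> (1/2) *\<^sub>R (h + l * l)"
    unfolding ySuc by (intro tendsto_intros l)
  from LIMSEQ_unique[OF LIMSEQ_Suc[OF l] this] have l_eq: "l = (1/2) *\<^sub>R (h + l * l)" .
  from arg_cong[OF l_eq, of "scaleR 2"] have ll: "2 *\<^sub>R l = h + l * l" by simp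
  have comm_l: "z * l = l * z" if "z * h = h * z" for z
  proof (rule LIMSEQ_unique)
    show "(\<lambda>n. z * y n) \<longlonglongrightarrow> z * l" by (intro tendsto_intros l)
    show "(\<lambda>n. z * y n) \<longlonglongrightarrow> l * z" unfolding comm[OF that] by (intro tendsto_intros l)
  qed
  show thesis
  proof (rule that)
    show "star (1 - l) = 1 - l" by (simp add: star_diff star_l)
    show "(1 - l) * (1 - l) = 1 - h"
      using ll by (simp add: algebra_simps scaleR_2)
    show "norm (1 - (1 - l)) \<le> 1" using norm_l by simp
    show "z * (1 - l) = (1 - l) * z" if "z * h = h * z" for z
      using comm_l[OF that] by (simp add: algebra_simps)
  qed
qed

text \<open>The condition \<open>norm (t *\<^sub>R 1 - a) \<le> t\<close> says that the spectrum of the self-adjoint \<open>a\<close> lies in \<open>[0, 2t]\<close>. In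
this form sums of positive elements are positive by the triangle inequality.\<close>

definition positive :: "'a::cstar_algebra \<Rightarrow> bool" where
  "positive a \<longleftrightarrow> star a = a \<and> (\<exists>t\<ge>0. norm (t *\<^sub>R 1 - a) \<le> t)"

lemma positive_star: "positive a \<Longrightarrow> star a = a"
  by (simp add: positive_def)

lemma positive_zero [simp]: "positive 0"
  by (auto simp: positive_def)

lemma positive_add:
  assumes "positive a" "positive b" shows "positive (a + b)"
proof -
  obtain s t where s: "0 \<le> s" "norm (s *\<^sub>R 1 - a) \<le> s" and t: "0 \<le> t" "norm (t *\<^sub>R 1 - b) \<le> t"
    using assms by (auto simp: positive_def)
  have "norm ((s + t) *\<^sub>R 1 - (a + b)) \<le> s + t"
    using norm_triangle_ineq[of "s *\<^sub>R 1 - a" "t *\<^sub>R 1 - b"] s t by (simp add: algebra_simps)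
  then show ?thesis using assms s t by (auto simp: positive_def star_add intro!: exI[of _ "s + t"])
qed

lemma positive_scaleR:
  assumes "0 \<le> r" "positive a" shows "positive (r *\<^sub>R a)"
proof -
  obtain t where t: "0 \<le> t" "norm (t *\<^sub>R 1 - a) \<le> t"
    using assms by (auto simp: positive_def)
  have "norm ((r * t) *\<^sub>R 1 - r *\<^sub>R a) = r * norm (t *\<^sub>R 1 - a)"
    using assms(1) by (metis abs_of_nonneg norm_scaleR scaleR_diff_right scaleR_scaleR)
  also have "\<dots> \<le> r * t" using t assms by (simp add: mult_left_mono)
  finally show ?thesis using assms t
    by (auto simp: positive_def star_scaleR intro!: exI[of _ "r * t"])
qed

lemma positive_sum: "(\<And>i. i \<in> I \<Longrightarrow> positive (f i)) \<Longrightarrow> positive (sum f I)"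
  by (induction I rule: infinite_finite_induct) (auto intro: positive_add)

lemma positive_one_diff:
  assumes "star a = a" "norm a \<le> s"
  shows "positive (s *\<^sub>R 1 - a)"
proof -
  have "0 \<le> s" using norm_ge_zero assms(2) by (rule order_trans)
  then show ?thesis using assms by (auto simp: positive_def star_diff star_scaleR intro!: exI[of _ s])
qed

lemma positive_one: "positive (1::'a::cstar_algebra)"
  using positive_one_diff[of "0::'a" 1] by simp

text \<open>If \<open>norm (t *\<^sub>R 1 - a) \<le> t\<close>, then \<open>a / t = 1 - h\<close> with \<open>norm h \<le> 1\<close>.\<close>

lemma positive_sqrt:
  assumes "positive a"
  obtains b where "positive b" "b * b = a" "\<And>z. z * a = a * z \<Longrightarrow> z * b = b * z"
proof -
  obtain t where t: "0 \<le> t" "norm (t *\<^sub>R 1 - a) \<le> t" and sa: "star a = a"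
    using assms by (auto simp: positive_def)
  show thesis
  proof (cases "t = 0")
    case True
    then show thesis using that[of 0] t by simp
  next
    case False
    define h where "h = 1 - (1/t) *\<^sub>R a"
    have h: "h = (1/t) *\<^sub>R (t *\<^sub>R 1 - a)" using False by (simp add: h_def scaleR_diff_right)
    have nh: "norm h \<le> 1" unfolding h using t False by simp
    have sh: "star h = h" by (simp add: h_def star_diff star_scaleR sa)
    obtain c where c: "star c = c" "c * c = 1 - h" "norm (1 - c) \<le> 1"
      "\<And>z. z * h = h * z \<Longrightarrow> z * c = c * z"
      using sqrt_one_minus[OF sh nh] by blast
    show thesis
    proof (rule that)
      have "positive c" using c(1,3) by (auto simp: positive_def intro!: exI[of _ 1])
      then show "positive (sqrt t *\<^sub>R c)" using t by (simp add: positive_scaleR)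
      show "sqrt t *\<^sub>R c * sqrt t *\<^sub>R c = a" using t False c(2) by (simp add: h_def)
      show "z * sqrt t *\<^sub>R c = sqrt t *\<^sub>R c * z" if "z * a = a * z" for z
        using c(4)[of z] that by (simp add: h_def algebra_simps)
    qed
  qed
qed

text \<open>After scaling, \<open>norm b \<le> 1\<close> and \<open>1 - b * b = c * c\<close> with \<open>c\<close> commuting with \<open>b\<close>; then
\<open>(norm c)\<^sup>2 \<le> norm (c * c + b * b) = norm 1\<close>. Through square roots this extends the inequality in the
definition of positivity to every \<open>s \<ge> norm a\<close>, so that positivity becomes a closed condition.\<close>

lemma norm_scaleR_one_diff_square_le:
  fixes b :: "'a::cstar_algebra"
  assumes sa: "star b = b" and bs: "norm (b * b) \<le> s"
  shows "norm (s *\<^sub>R 1 - b * b) \<le> s"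
proof (cases "s = 0")
  case True
  then show ?thesis using bs by simp
next
  case False
  with bs norm_ge_zero[of "b * b"] have s: "0 < s" by linarith
  define h where "h = (1/s) *\<^sub>R (b * b)"
  define d where "d = (1/sqrt s) *\<^sub>R b"
  have dd: "d * d = h" using s by (simp add: d_def h_def)
  have nh: "norm h \<le> 1" using s bs by (simp add: h_def)
  have sh: "star h = h" by (simp add: h_def star_scaleR star_mult sa)
  obtain c where c: "star c = c" "c * c = 1 - h" 
      "\<And>z. z * h = h * z \<Longrightarrow> z * c = c * z"
    using sqrt_one_minus[OF sh nh] by blast
  have "d * h = h * d" by (simp add: mult.assoc flip: dd)
  then have "c * d = d * c" using c(3) by simp
  then have "(norm c)\<^sup>2 \<le> norm (c * c + d * d)"
    by (intro commuting_square_norm_le) (simp_all add: c(1) d_def star_scaleR sa)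
  also have "\<dots> = norm (1::'a)" by (simp add: c(2) dd)
  also have "\<dots> \<le> 1" by (rule norm_one_le)
  finally have nc: "(norm c)\<^sup>2 \<le> 1" .
  have "norm (1 - h) \<le> 1" using norm_self_adjoint_square[OF c(1)] c(2) nc by simp
  moreover have "s *\<^sub>R 1 - b * b = s *\<^sub>R (1 - h)" using s by (simp add: h_def scaleR_diff_right)
  ultimately show ?thesis using s by simp
qed

lemma positive_norm_diff_le:
  assumes "positive a" "norm a \<le> s"
  shows "norm (s *\<^sub>R 1 - a) \<le> s"
proof -
  obtain b where "positive b" "b * b = a" using positive_sqrt[OF assms(1)] by blast
  then show ?thesis using norm_scaleR_one_diff_square_le[of b s] assms(2) by (simp add: positive_star)
qed

lemma positive_self_adjoint_square: "star b = b \<Longrightarrow> positive (b * b)"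
  using norm_scaleR_one_diff_square_le[of b "norm (b * b)"]
  by (auto simp: positive_def star_mult intro!: exI[of _ "norm (b * b)"])

text \<open>With \<open>s = norm b\<close> both \<open>a\<close> and \<open>s - a = (s - b) + (b - a)\<close> are positive. They commute, so their square roots
do, and the norm of \<open>a\<close> is at most that of the sum of the two squares, which is \<open>s\<close>.\<close>

lemma positive_norm_mono:
  assumes a: "positive a" and ab: "positive (b - a)"
  shows "norm a \<le> norm b"
proof -
  define s where "s = norm b"
  have "star b = star (b - a) + star a" by (simp flip: star_add)
  then have sb: "star b = b" using assms[THEN positive_star] by simp
  have "positive ((s *\<^sub>R 1 - b) + (b - a))"
    by (intro positive_add positive_one_diff sb ab) (simp add: s_def)
  then have "positive (s *\<^sub>R 1 - a)" by simp
  from positive_sqrt[OF this] obtain c where c: "positive c" "c * c = s *\<^sub>R 1 - a"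
    "\<And>z. z * (s *\<^sub>R 1 - a) = (s *\<^sub>R 1 - a) * z \<Longrightarrow> z * c = c * z"
    by blast
  obtain d where d: "positive d" "d * d = a" using positive_sqrt[OF a] by blast
  have "d * a = a * d" by (simp add: mult.assoc flip: d(2))
  then have "d * c = c * d" by (intro c(3)) (simp add: algebra_simps)
  then have "(norm d)\<^sup>2 \<le> norm (d * d + c * c)"
    using c(1) d(1) by (intro commuting_square_norm_le) (simp_all add: positive_star)
  also have "\<dots> = norm (s *\<^sub>R (1::'a))" using c(2) d(2) by simp
  also have "\<dots> \<le> s" by (rule norm_scaleR_one_le) (simp add: s_def)
  finally show ?thesis
    using norm_self_adjoint_square[of d] d positive_star[of d] by (simp add: s_def)
qed

lemma positive_lim:
  assumes "\<And>n. positive (X n)" "X \<longlonglongrightarrow> a"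
  shows "positive a"
proof -
  have "(\<lambda>n. star (X n)) \<longlonglongrightarrow> star a" using assms(2) by (rule tendsto_star)
  then have "star a = a" using assms LIMSEQ_unique by (simp add: positive_star)
  moreover have "norm (norm a *\<^sub>R 1 - a) \<le> norm a"
  proof (rule LIMSEQ_le)
    show "(\<lambda>n. norm (norm (X n) *\<^sub>R 1 - X n)) \<longlonglongrightarrow> norm (norm a *\<^sub>R 1 - a)"
      by (intro tendsto_intros assms(2))
    show "(\<lambda>n. norm (X n)) \<longlonglongrightarrow> norm a" by (intro tendsto_intros assms(2))
    show "\<exists>N. \<forall>n\<ge>N. norm (norm (X n) *\<^sub>R 1 - X n) \<le> norm (X n)"
      using assms(1) positive_norm_diff_le by blast
  qed
  ultimately show ?thesis unfolding positive_def using norm_ge_zero by blast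
qed

lemma positive_mult:
  assumes p: "positive p" and q: "positive q" and pq: "p * q = q * p"
  shows "positive (p * q)"
proof -
  obtain b where b: "positive b" "b * b = p" "\<And>z. z * p = p * z \<Longrightarrow> z * b = b * z"
    using positive_sqrt[OF p] by blast
  obtain c where c: "positive c" "c * c = q" "\<And>z. z * q = q * z \<Longrightarrow> z * c = c * z"
    using positive_sqrt[OF q] by blast
  have "b * q = q * b" using b(3)[of q] pq by simp
  then have cb: "b * c = c * b" by (rule c(3))
  have "b * c * (b * c) = b * (c * b) * c" by (simp only: mult.assoc)
  also have "\<dots> = b * (b * c) * c" by (simp only: cb)
  also have "\<dots> = p * q" by (simp only: mult.assoc flip: b(2) c(2))
  finally have "p * q = b * c * (b * c)" by (rule sym)
  moreover have "star (b * c) = b * c" using b(1) c(1) cb by (simp add: star_mult positive_star)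
  ultimately show ?thesis by (metis positive_self_adjoint_square)
qed

text \<open>Write \<open>q = x * star x\<close>. With the real and imaginary parts \<open>h\<close> and \<open>k\<close> of \<open>x\<close> one has
\<open>star x * x + q = 2 h\<^sup>2 + 2 k\<^sup>2\<close>, so \<open>q\<close> is positive if \<open>- (star x * x)\<close> is. Classically one concludes by
comparing the spectra of \<open>star x * x\<close> and \<open>x * star x\<close>. Here the comparison is replaced by a growth argument:
\<open>(1 + q) ^ n * q = x * (1 + star x * x) ^ n * star x\<close> stays bounded, because \<open>1 + star x * x\<close> is a contraction,
yet it dominates \<open>n *\<^sub>R (q * q)\<close>; hence \<open>q = 0\<close>.\<close>

lemma contraction_star_mult_self_negative_imp_zero:
  fixes x :: "'a::cstar_algebra"
  assumes p: "positive (- (star x * x))" and x1: "norm x \<le> 1"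
  shows "x = 0"
proof -
  define q where "q = x * star x"
  define h where "h = (1/2) *\<^sub>R (x + star x)"
  define k where "k = - ((\<i> / 2) *\<^sub>C (x - star x))"
  have sh: "star h = h" by (simp add: h_def star_scaleR star_add star_star add.commute)
  have sk: "star k = k" by (simp add: k_def star_scaleC star_minus star_diff star_star minus_scaleC scaleC_diff_right)
  have "k * k = -((1/4) *\<^sub>C ((x - star x) * (x - star x)))"
    by (simp add: k_def mult_scaleC_left mult_scaleC_right scaleC_scaleC minus_scaleC scaleC_minus)
  also have "\<dots> = - ((1/4) *\<^sub>R ((x - star x) * (x - star x)))"
    by (simp add: scaleR_scaleC)
  finally have "2 *\<^sub>R (h * h) + 2 *\<^sub>R (k * k) =
    (1/2) *\<^sub>R ((x + star x) * (x + star x) - (x - star x) * (x - star x))"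
    by (simp add: h_def scaleR_diff_right)
  also have "\<dots> = (1/2) *\<^sub>R (2 *\<^sub>R (star x * x + q))"
    by (rule arg_cong[of _ _ "scaleR (1/2)"]) (simp add: q_def algebra_simps scaleR_2)
  finally have q_eq: "q = 2 *\<^sub>R (h * h) + 2 *\<^sub>R (k * k) + - (star x * x)" by simp
  then have q: "positive q"
    unfolding q_eq
    by (intro positive_add positive_scaleR positive_self_adjoint_square p sh sk) simp_all
  define e where "e = 1 + star x * x"
  have "norm (1 *\<^sub>R 1 - (- (star x * x))) \<le> 1"
    by (rule positive_norm_diff_le[OF p]) (simp add: cstar_identity x1 power_le_one)
  then have e: "norm e \<le> 1" by (simp add: e_def)
  have e_pow: "norm (e ^ n) \<le> 1" for n
  proof (induction n)
    case (Suc n)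
    then show ?case using norm_mult_ineq[of e "e ^ n"] e
      by (metis mult_le_one norm_ge_zero order_trans power_Suc)
  qed (simp add: norm_one_le)
  have xe1: "x * e = (1 + q) * x" by (simp add: e_def q_def algebra_simps)
  have xe: "x * e ^ n = (1 + q) ^ n * x" for n
  proof (induction n)
    case (Suc n)
    have "x * e ^ Suc n = x * e ^ n * e" by (simp only: power_Suc2 mult.assoc)
    also have "\<dots> = (1 + q) ^ n * (x * e)" by (simp only: Suc mult.assoc)
    also have "\<dots> = (1 + q) ^ Suc n * x" by (simp only: xe1 power_Suc2 mult.assoc)
    finally show ?case .
  qed simp
  have bound: "norm ((1 + q) ^ n * q) \<le> 1" for n
  proof -
    have "(1 + q) ^ n * q = x * e ^ n * star x" by (simp add: xe q_def mult.assoc)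
    also have "norm \<dots> \<le> norm x * norm (e ^ n) * norm (star x)"
      by (meson mult_right_mono norm_ge_zero norm_mult_ineq order_trans)
    also have "\<dots> \<le> 1" using x1 e_pow[of n] by (simp add: mult_le_one)
    finally show ?thesis .
  qed
  \<comment> \<open>The additional \<open>q\<close> makes the induction work: multiplied by \<open>q\<close>, it supplies the next \<open>q * q\<close>.\<close>
  have pos: "positive ((1 + q) ^ n * q - (real n *\<^sub>R (q * q) + q))" for n
  proof (induction n)
    case (Suc n)
    define W where "W = (1 + q) ^ n * q"
    have "(1 + q) ^ n * (1 + q) = (1 + q) * (1 + q) ^ n" by (rule power_commutes)
    then have "(1 + q) ^ n * q = q * (1 + q) ^ n" by (simp only: distrib_left distrib_right) simp
    then have Wq: "W * q = q * W" by (simp add: W_def mult.assoc)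
    have WS: "(1 + q) ^ Suc n * q = (1 + q) * W" by (simp only: W_def power_Suc mult.assoc)
    have "(1 + q) * W - (real (Suc n) *\<^sub>R (q * q) + q) =
      (1 + q) * (W - (real n *\<^sub>R (q * q) + q)) + real n *\<^sub>R (q * (q * q))"
      by (simp add: algebra_simps)
    then have "(1 + q) ^ Suc n * q - (real (Suc n) *\<^sub>R (q * q) + q) =
      (1 + q) * (W - (real n *\<^sub>R (q * q) + q)) + real n *\<^sub>R (q * (q * q))"
      by (simp only: WS)
    moreover have "positive ((1 + q) * (W - (real n *\<^sub>R (q * q) + q)))"
    proof (rule positive_mult)
      show "positive (1 + q)" by (intro positive_add positive_one q)
      show "positive (W - (real n *\<^sub>R (q * q) + q))" using Suc by (simp only: W_def)
      show "(1 + q) * (W - (real n *\<^sub>R (q * q) + q)) = (W - (real n *\<^sub>R (q * q) + q)) * (1 + q)"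
        by (simp add: algebra_simps Wq)
    qed
    moreover have "positive (real n *\<^sub>R (q * (q * q)))"
    proof (rule positive_scaleR)
      show "positive (q * (q * q))"
        by (intro positive_mult q) (simp_all add: mult.assoc)
    qed simp
    ultimately show ?case by (simp only: positive_add)
  qed simp
  have "real n * norm (q * q) \<le> 1" for n
  proof -
    have "norm (real n *\<^sub>R (q * q)) \<le> norm ((1 + q) ^ n * q)"
    proof (rule positive_norm_mono)
      show "positive (real n *\<^sub>R (q * q))"
        using q by (intro positive_scaleR positive_self_adjoint_square positive_star) auto
      have "positive ((1 + q) ^ n * q - (real n *\<^sub>R (q * q) + q) + q)"
        by (intro positive_add pos q)
      then show "positive ((1 + q) ^ n * q - real n *\<^sub>R (q * q))" by simp
    qed
    then show ?thesis using bound[of n] by simp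
  qed
  then have "norm (q * q) = 0"
    by (metis norm_ge_zero reals_Archimedean3 order_less_le not_less)
  then have "norm q = 0" using norm_self_adjoint_square[of q] positive_star[OF q] by simp
  then have "(norm (star x))\<^sup>2 = 0"
    using cstar_identity[of "star x"] by (simp add: q_def star_star)
  then show ?thesis by simp
qed

lemma star_mult_self_negative_imp_zero:
  fixes x :: "'a::cstar_algebra"
  assumes "positive (- (star x * x))"
  shows "x = 0"
proof -
  define r where "r = 1 / (norm x + 1)"
  have r: "r > 0" by (simp add: r_def add_nonneg_pos)
  have "r *\<^sub>R x = 0"
  proof (rule contraction_star_mult_self_negative_imp_zero)
    show "norm (r *\<^sub>R x) \<le> 1" using r by (simp add: r_def divide_simps) (smt (verit) norm_ge_zero)
    have "positive ((r * r) *\<^sub>R (- (star x * x)))" using assms r by (intro positive_scaleR) auto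
    then show "positive (- (star (r *\<^sub>R x) * (r *\<^sub>R x)))" by (simp add: star_scaleR)
  qed
  then show ?thesis using r by simp
qed

text \<open>Let \<open>d\<close> be the positive square root of \<open>a * a\<close> for \<open>a = star x * x\<close>, that is, the absolute value of \<open>a\<close>, and
let \<open>m = d - a\<close> be twice the negative part. As \<open>m * (d + a) = 0\<close>, the element \<open>star (x * m) * (x * m) = m * a * m\<close>
is minus a square, so \<open>x * m = 0\<close> by the previous result, and this forces \<open>m = 0\<close>. To see the square one
writes \<open>d = b * b\<close> once more.\<close>

proposition positive_star_mult_self: "positive (star x * (x::'a::cstar_algebra))"
proof -
  define a where "a = star x * x"
  have sa: "star a = a" by (simp add: a_def star_mult star_star)
  obtain d where d: "positive d" "d * d = a * a" "\<And>z. z * (a * a) = (a * a) * z \<Longrightarrow> z * d = d * z"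
    using positive_sqrt[OF positive_self_adjoint_square[OF sa]] by blast
  obtain b where b: "positive b" "b * b = d" "\<And>z. z * d = d * z \<Longrightarrow> z * b = b * z"
    using positive_sqrt[OF d(1)] by blast
  have ad: "a * d = d * a" by (rule d(3)) (simp add: mult.assoc)
  define m where "m = d - a"
  have sm: "star m = m" using d(1) sa by (simp add: m_def star_diff positive_star)
  have md: "m * d = d * m" by (simp add: m_def algebra_simps ad)
  have mb: "m * b = b * m" by (rule b(3)) (rule md)
  have "m * (d + a) = 0" by (simp add: m_def algebra_simps d(2) ad)
  then have ma: "m * a = - (m * d)" by (simp add: distrib_left eq_neg_iff_add_eq_0 add.commute)
  \<comment> \<open>This will show \<open>m = 0\<close> once \<open>m * d = 0\<close> is known.\<close>
  have mm: "m * m = 2 *\<^sub>R (m * d)"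
  proof -
    have "m * m = m * d - m * a" by (simp add: m_def algebra_simps)
    then show ?thesis by (simp add: ma scaleR_2)
  qed
  have "star (x * m) * (x * m) = m * a * m" by (simp add: star_mult sm a_def mult.assoc)
  also have "\<dots> = - (b * m * (b * m))"
  proof -
    have "b * m * (b * m) = m * b * (b * m)" by (simp only: mb)
    also have "\<dots> = m * d * m" by (simp only: mult.assoc flip: b(2))
    finally show ?thesis by (simp add: ma)
  qed
  finally have "positive (- (star (x * m) * (x * m)))"
    using b(1) sm mb by (simp add: positive_self_adjoint_square star_mult positive_star)
  then have "x * m = 0" by (rule star_mult_self_negative_imp_zero)
  then have "a * m = 0" by (simp add: a_def mult.assoc)
  then have "star (a * m) = 0" by simp
  then have "m * d = 0" using ma sa sm by (simp add: star_mult)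
  then have "(norm m)\<^sup>2 = 0" using mm norm_self_adjoint_square[OF sm] by simp
  then have "a = d" by (simp add: m_def)
  then show ?thesis using d(1) by (simp add: a_def)
qed

lemma positive_conjugate:
  assumes "positive p" shows "positive (star b * p * b)"
proof -
  obtain c where c: "positive c" "c * c = p" using positive_sqrt[OF assms] by blast
  then have "star b * p * b = star (c * b) * (c * b)"
    by (simp add: star_mult positive_star mult.assoc flip: c(2))
  then show ?thesis by (metis positive_star_mult_self)
qed

section \<open>The standard module as a Banach space\<close>

lemma norm_sum_positive_mono:
  assumes "\<And>i. i \<in> I \<Longrightarrow> positive (a i)" "\<And>i. i \<in> I \<Longrightarrow> positive (b i - a i)"
  shows "norm (sum a I) \<le> norm (sum b I)"
  by (rule positive_norm_mono) (simp_all add: positive_sum assms flip: sum_subtractf)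

text \<open>Monotonicity of the norm turns the Cauchy criterion for the larger series into that for the smaller one.\<close>

lemma summable_positive_comparison:
  assumes "\<And>n. positive (a n)" "\<And>n. positive (b n - a n)" "summable b"
  shows "summable a"
  unfolding summable_Cauchy
proof (intro allI impI)
  fix e :: real assume "0 < e"
  with assms(3) obtain N where N: "\<And>m n. m \<ge> N \<Longrightarrow> norm (sum b {m..<n}) < e"
    unfolding summable_Cauchy by blast
  have "norm (sum a {m..<n}) < e" if "m \<ge> N" for m n
    using norm_sum_positive_mono[of "{m..<n}" a b] N[OF that, of n] assms(1,2) by auto
  then show "\<exists>N. \<forall>m\<ge>N. \<forall>n. norm (sum a {m..<n}) < e" by blast
qed

lemma bounded_linear_scaleC: "bounded_linear (\<lambda>x::'a::cstar_algebra. c *\<^sub>C x)"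
  by (rule bounded_linear_intro[where K = "cmod c"])
    (simp_all add: scaleC_add_right norm_scaleC scaleR_scaleC scaleC_scaleC mult.commute)

lemma HA_zero [simp]: "0 \<in> HA"
  by (simp add: HA_def)

lemma HA_rmult:
  assumes "x \<in> HA" shows "x \<cdot>\<^sub>A a \<in> HA"
proof -
  have "summable (\<lambda>n. star a * (star (x n) * x n) * a)"
    using assms by (intro summable_mult summable_mult2) (simp add: HA_def)
  then show ?thesis by (simp add: HA_def rmult_def star_mult mult.assoc)
qed

lemma HA_add:
  assumes "x \<in> HA" "y \<in> HA" shows "x + y \<in> HA"
proof -
  have "summable (\<lambda>n. star ((x + y) n) * (x + y) n)"
  proof (rule summable_positive_comparison)
    show "summable (\<lambda>n. 2 *\<^sub>R (star (x n) * x n) + 2 *\<^sub>R (star (y n) * y n))"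
      using assms by (intro summable_add summable_scaleR_right) (simp_all add: HA_def)
    have "2 *\<^sub>R (star (x n) * x n) + 2 *\<^sub>R (star (y n) * y n) - star ((x + y) n) * (x + y) n =
      star (x n - y n) * (x n - y n)" for n
      by (simp add: star_add star_diff algebra_simps scaleR_2)
    then show "positive (2 *\<^sub>R (star (x n) * x n) + 2 *\<^sub>R (star (y n) * y n)
        - star ((x + y) n) * (x + y) n)" for n
      by (simp only: positive_star_mult_self)
  qed (rule positive_star_mult_self)
  then show ?thesis by (simp add: HA_def)
qed

lemma HA_minus: "x \<in> HA \<Longrightarrow> - x \<in> HA"
  by (simp add: HA_def star_minus)

lemma HA_diff: "x \<in> HA \<Longrightarrow> y \<in> HA \<Longrightarrow> x - y \<in> HA"
  using HA_add[of x "- y"] HA_minus[of y] by simp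

lemma HA_scaleC:
  assumes "x \<in> HA" shows "(\<lambda>n. c *\<^sub>C x n) \<in> HA"
proof -
  have "summable (\<lambda>n. (cnj c * c) *\<^sub>C (star (x n) * x n))"
    using assms by (intro bounded_linear.summable[OF bounded_linear_scaleC]) (simp add: HA_def)
  then show ?thesis
    by (simp add: HA_def star_scaleC mult_scaleC_left mult_scaleC_right scaleC_scaleC mult.commute)
qed

text \<open>Polarization: \<open>2 \<langle>x, y\<rangle>\<close> is the combination of \<open>\<langle>x, z\<rangle> + \<langle>z, x\<rangle>\<close> for \<open>z = y\<close> and \<open>z = \<i> y\<close>, and each of those is
\<open>\<langle>x + z, x + z\<rangle> - \<langle>x, x\<rangle> - \<langle>z, z\<rangle>\<close>.\<close>

lemma summable_hinner:
  assumes x: "x \<in> HA" and y: "y \<in> HA"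
  shows "summable (\<lambda>n. star (x n) * y n)"
proof -
  have sym: "summable (\<lambda>n. star (x n) * z n + star (z n) * x n)" if z: "z \<in> HA" for z
  proof -
    have "summable (\<lambda>n. star ((x + z) n) * (x + z) n - star (x n) * x n - star (z n) * z n)"
      using HA_add[OF x z] x z by (intro summable_diff) (simp_all add: HA_def)
    then show ?thesis by (simp add: star_add algebra_simps)
  qed
  have "summable (\<lambda>n. (star (x n) * y n + star (y n) * x n)
      + (-\<i>) *\<^sub>C (star (x n) * (\<i> *\<^sub>C y n) + star (\<i> *\<^sub>C y n) * x n))"
    by (intro summable_add sym y bounded_linear.summable[OF bounded_linear_scaleC]
        sym[OF HA_scaleC[OF y], of \<i>])
  also have "(\<lambda>n. (star (x n) * y n + star (y n) * x n)
      + (-\<i>) *\<^sub>C (star (x n) * (\<i> *\<^sub>C y n) + star (\<i> *\<^sub>C y n) * x n)) =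
      (\<lambda>n. 2 *\<^sub>R (star (x n) * y n))"
    by (simp add: star_scaleC mult_scaleC_left mult_scaleC_right scaleC_scaleC scaleC_add_right
        minus_one_scaleC one_scaleC scaleR_2)
  finally show ?thesis
    using summable_scaleR_right[of "\<lambda>n. 2 *\<^sub>R (star (x n) * y n)" "1/2"] by simp
qed

lemma hinner_add_right:
  "x \<in> HA \<Longrightarrow> y \<in> HA \<Longrightarrow> z \<in> HA \<Longrightarrow> hinner x (y + z) = hinner x y + hinner x z"
  by (simp add: hinner_def distrib_left suminf_add summable_hinner)

lemma hinner_add_left:
  "x \<in> HA \<Longrightarrow> y \<in> HA \<Longrightarrow> z \<in> HA \<Longrightarrow> hinner (x + y) z = hinner x z + hinner y z"
  by (simp add: hinner_def distrib_right star_add suminf_add summable_hinner)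

lemma hinner_diff_right:
  "x \<in> HA \<Longrightarrow> y \<in> HA \<Longrightarrow> z \<in> HA \<Longrightarrow> hinner x (y - z) = hinner x y - hinner x z"
  by (simp add: hinner_def right_diff_distrib suminf_diff summable_hinner)

lemma hinner_diff_left:
  "x \<in> HA \<Longrightarrow> y \<in> HA \<Longrightarrow> z \<in> HA \<Longrightarrow> hinner (x - y) z = hinner x z - hinner y z"
  by (simp add: hinner_def left_diff_distrib star_diff suminf_diff summable_hinner)

lemma star_hinner: "x \<in> HA \<Longrightarrow> y \<in> HA \<Longrightarrow> star (hinner x y) = hinner y x"
  by (simp add: hinner_def bounded_linear.suminf[OF bounded_linear_star] summable_hinner
      star_mult star_star)

lemma hinner_rmult_right:
  assumes "x \<in> HA" "y \<in> HA" shows "hinner x (y \<cdot>\<^sub>A a) = hinner x y * a"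
proof -
  have "(\<Sum>n. star (x n) * y n * a) = (\<Sum>n. star (x n) * y n) * a"
    using summable_hinner[OF assms] by (rule suminf_mult2[symmetric])
  then show ?thesis by (simp add: hinner_def rmult_def mult.assoc)
qed

lemma hinner_rmult_left:
  assumes "x \<in> HA" "y \<in> HA" shows "hinner (x \<cdot>\<^sub>A a) y = star a * hinner x y"
proof -
  have "(\<Sum>n. star a * (star (x n) * y n)) = star a * (\<Sum>n. star (x n) * y n)"
    using summable_hinner[OF assms] by (rule suminf_mult)
  then show ?thesis by (simp add: hinner_def rmult_def star_mult mult.assoc)
qed

lemma positive_hinner:
  assumes "x \<in> HA" shows "positive (hinner x x)"
proof (rule positive_lim)
  show "(\<lambda>N. \<Sum>n<N. star (x n) * x n) \<longlonglongrightarrow> hinner x x"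
    unfolding hinner_def using assms by (intro summable_LIMSEQ) (simp add: HA_def)
qed (rule positive_sum, rule positive_star_mult_self)

lemma hnorm_nonneg [simp]: "0 \<le> hnorm x"
  by (simp add: hnorm_def)

lemma hnorm_square: "(hnorm x)\<^sup>2 = norm (hinner x x)"
  by (simp add: hnorm_def)

lemma hnorm_le_iff: "0 \<le> c \<Longrightarrow> hnorm x \<le> c \<longleftrightarrow> norm (hinner x x) \<le> c\<^sup>2"
  by (metis hnorm_nonneg hnorm_square power2_le_imp_le power_mono)

text \<open>Cutting a sequence off outside a finite set always lands in the module. This makes module inequalities
applicable to finite sections of a sequence whose membership is still to be shown, as in the proof of
completeness.\<close>

definition restrict_seq :: "nat set \<Rightarrow> (nat \<Rightarrow> 'a::cstar_algebra) \<Rightarrow> nat \<Rightarrow> 'a" where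
  "restrict_seq I x = (\<lambda>n. if n \<in> I then x n else 0)"

lemma restrict_seq_HA:
  assumes "x \<in> HA" shows "restrict_seq I x \<in> HA"
proof -
  have "summable (\<lambda>n. star (restrict_seq I x n) * restrict_seq I x n)"
    by (rule summable_positive_comparison[where b = "\<lambda>n. star (x n) * x n"])
      (use assms in \<open>auto simp: HA_def restrict_seq_def positive_star_mult_self\<close>)
  then show ?thesis by (simp add: HA_def)
qed

lemma restrict_seq_finite_HA: "finite I \<Longrightarrow> restrict_seq I x \<in> HA"
  by (auto simp: HA_def restrict_seq_def intro!: summable_finite[of I])

lemma hinner_restrict_seq_finite:
  "finite I \<Longrightarrow> hinner (restrict_seq I x) (restrict_seq I x) = (\<Sum>n\<in>I. star (x n) * x n)"
  unfolding hinner_def by (subst suminf_finite[of I]) (auto simp: restrict_seq_def)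

lemma hnorm_restrict_seq_le:
  assumes "x \<in> HA" shows "hnorm (restrict_seq I x) \<le> hnorm x"
proof -
  let ?r = "restrict_seq I x" and ?s = "restrict_seq (- I) x"
  note r = restrict_seq_HA[OF assms]
  have "hinner x x - hinner ?r ?r = (\<Sum>n. star (x n) * x n - star (?r n) * ?r n)"
    unfolding hinner_def by (intro suminf_diff summable_hinner r assms)
  also have "(\<lambda>n. star (x n) * x n - star (?r n) * ?r n) = (\<lambda>n. star (?s n) * ?s n)"
    by (auto simp: restrict_seq_def)
  finally have "hinner x x - hinner ?r ?r = hinner ?s ?s" by (simp add: hinner_def)
  then have "norm (hinner ?r ?r) \<le> norm (hinner x x)"
    by (intro positive_norm_mono positive_hinner r) (simp add: positive_hinner r)
  then show ?thesis by (simp add: hnorm_def)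
qed

lemma norm_coordinate_le:
  assumes "x \<in> HA" shows "norm (x n) \<le> hnorm x"
  using hnorm_restrict_seq_le[OF assms, of "{n}"]
  by (simp add: hnorm_def hinner_restrict_seq_finite cstar_identity)

lemma hnorm_zero [simp]: "hnorm 0 = 0"
  by (simp add: hnorm_def hinner_def)

lemma hnorm_eq_zero_iff: "x \<in> HA \<Longrightarrow> hnorm x = 0 \<longleftrightarrow> x = 0"
proof
  assume x: "x \<in> HA" and "hnorm x = 0"
  then have "norm (x n) \<le> 0" for n using norm_coordinate_le[OF x, of n] by simp
  then show "x = 0" by (auto simp: fun_eq_iff)
qed simp

text \<open>For \<open>s = (hnorm x)\<^sup>2\<close> and \<open>a = \<langle>x, y\<rangle> / s\<close>, expand \<open>\<langle>x a - y, x a - y\<rangle>\<close> and use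
\<open>star a * \<langle>x, x\<rangle> * a \<le> s (star a * a)\<close>: what remains is \<open>s (star a * a) \<le> \<langle>y, y\<rangle>\<close>, and one takes norms.\<close>

proposition hinner_Cauchy_Schwarz:
  assumes x: "x \<in> HA" and y: "y \<in> HA"
  shows "norm (hinner x y) \<le> hnorm x * hnorm y"
proof (cases "hnorm x = 0")
  case True
  then show ?thesis using x by (simp add: hnorm_eq_zero_iff hinner_def)
next
  case False
  define s where "s = (hnorm x)\<^sup>2"
  have s: "0 < s" using False by (simp add: s_def)
  define a where "a = (1/s) *\<^sub>R hinner x y"
  have xy: "hinner x y = s *\<^sub>R a" using s by (simp add: a_def)
  have yx: "hinner y x = s *\<^sub>R star a"
    using star_hinner[OF x y] by (simp add: xy star_scaleR)
  define z where "z = x \<cdot>\<^sub>A a - y"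
  note xa = HA_rmult[OF x, of a]
  have zz: "hinner z z = star a * hinner x x * a - s *\<^sub>R (star a * a) - s *\<^sub>R (star a * a) + hinner y y"
    using x y xa
    by (simp add: z_def hinner_diff_left hinner_diff_right HA_diff hinner_rmult_left hinner_rmult_right
        xy yx mult.assoc left_diff_distrib)
  have "positive (hinner z z + star a * (s *\<^sub>R 1 - hinner x x) * a)"
    unfolding s_def hnorm_square
    by (intro positive_add positive_conjugate positive_one_diff positive_hinner
        positive_star[OF positive_hinner] x) (simp_all add: z_def HA_diff xa y)
  then have "positive (hinner y y - s *\<^sub>R (star a * a))"
    by (simp add: zz left_diff_distrib right_diff_distrib)
  then have "norm (s *\<^sub>R (star a * a)) \<le> norm (hinner y y)"
    using s by (intro positive_norm_mono positive_scaleR positive_star_mult_self) auto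
  then have "s * (norm a)\<^sup>2 \<le> (hnorm y)\<^sup>2"
    using s by (simp add: cstar_identity hnorm_square)
  then have "s * (s * (norm a)\<^sup>2) \<le> s * (hnorm y)\<^sup>2" using s by (intro mult_left_mono) auto
  then have "(norm (hinner x y))\<^sup>2 \<le> (hnorm x * hnorm y)\<^sup>2"
    using s by (simp add: xy power_mult_distrib s_def power2_eq_square mult_ac)
  then show ?thesis by (rule power2_le_imp_le) simp
qed

lemma hnorm_triangle:
  assumes x: "x \<in> HA" and y: "y \<in> HA"
  shows "hnorm (x + y) \<le> hnorm x + hnorm y"
proof -
  have "hinner (x + y) (x + y) = hinner x x + hinner x y + (hinner y x + hinner y y)"
    using x y by (simp add: hinner_add_left hinner_add_right HA_add)
  then have "norm (hinner (x + y) (x + y)) \<le>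
      norm (hinner x x) + norm (hinner x y) + (norm (hinner y x) + norm (hinner y y))"
    by (metis norm_add_rule_thm order_refl)
  also have "\<dots> \<le> (hnorm x)\<^sup>2 + hnorm x * hnorm y + (hnorm y * hnorm x + (hnorm y)\<^sup>2)"
    unfolding hnorm_square by (intro add_mono hinner_Cauchy_Schwarz x y order_refl)
  also have "\<dots> = (hnorm x + hnorm y)\<^sup>2" by (simp add: power2_eq_square algebra_simps)
  finally show ?thesis by (simp add: hnorm_le_iff)
qed

lemma hnorm_minus [simp]: "hnorm (- x) = hnorm x"
  by (simp add: hnorm_def hinner_def star_minus)

lemma hnorm_triangle_diff: "x \<in> HA \<Longrightarrow> y \<in> HA \<Longrightarrow> hnorm (x - y) \<le> hnorm x + hnorm y"
  using hnorm_triangle[of x "- y"] by (simp add: HA_minus)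

lemma hnorm_rmult_le:
  assumes "x \<in> HA" shows "hnorm (x \<cdot>\<^sub>A a) \<le> norm a * hnorm x"
proof -
  have "norm (hinner (x \<cdot>\<^sub>A a) (x \<cdot>\<^sub>A a)) = norm (star a * hinner x x * a)"
    using assms by (simp add: hinner_rmult_left hinner_rmult_right HA_rmult mult.assoc)
  also have "\<dots> \<le> norm (star a) * norm (hinner x x) * norm a"
    by (meson mult_right_mono norm_ge_zero norm_mult_ineq order_trans)
  also have "\<dots> = (norm a * hnorm x)\<^sup>2"
    by (simp add: power_mult_distrib power2_eq_square flip: hnorm_square)
  finally show ?thesis by (simp add: hnorm_le_iff)
qed

lemma hnorm_rmult_real: "hnorm (x \<cdot>\<^sub>A (r *\<^sub>R 1)) = \<bar>r\<bar> * hnorm x" if "x \<in> HA"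
proof -
  have "hinner (x \<cdot>\<^sub>A (r *\<^sub>R 1)) (x \<cdot>\<^sub>A (r *\<^sub>R 1)) = (r * r) *\<^sub>R hinner x x"
    using that by (simp add: hinner_rmult_left hinner_rmult_right HA_rmult star_scaleR)
  then show ?thesis by (simp add: hnorm_def real_sqrt_mult)
qed

text \<open>Coordinates converge because they are dominated by the module norm. The Cauchy estimate for a finite section
survives the limit, with a bound independent of the section; this gives first that the limit
sequence is in the module, and then convergence in norm.\<close>

proposition HA_complete:
  assumes X: "\<And>k. X k \<in> HA"
    and Cauchy: "\<And>e. 0 < e \<Longrightarrow> \<exists>N. \<forall>k\<ge>N. \<forall>l\<ge>N. hnorm (X k - X l) < e"
  shows "\<exists>x\<in>HA. (\<lambda>k. hnorm (X k - x)) \<longlonglongrightarrow> 0"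
proof -
  have "Cauchy (\<lambda>k. X k n)" for n
  proof (rule metric_CauchyI)
    fix e :: real assume "0 < e"
    then obtain N where N: "\<And>k l. k \<ge> N \<Longrightarrow> l \<ge> N \<Longrightarrow> hnorm (X k - X l) < e"
      using Cauchy by blast
    have "dist (X k n) (X l n) < e" if "k \<ge> N" "l \<ge> N" for k l
      using norm_coordinate_le[OF HA_diff[OF X X], of k l n] N[OF that] by (simp add: dist_norm)
    then show "\<exists>N. \<forall>k\<ge>N. \<forall>l\<ge>N. dist (X k n) (X l n) < e" by blast
  qed
  then have "\<exists>l. (\<lambda>k. X k n) \<longlonglongrightarrow> l" for n
    by (simp add: Cauchy_convergent_iff convergent_def)
  then obtain x where x: "\<And>n. (\<lambda>k. X k n) \<longlonglongrightarrow> x n" by metis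
  have close: "norm (\<Sum>n\<in>I. star ((X k - x) n) * (X k - x) n) \<le> e\<^sup>2"
    if I: "finite I" and e: "0 < e" and k: "\<And>l. l \<ge> k \<Longrightarrow> hnorm (X k - X l) < e" for I k e
  proof (rule LIMSEQ_le_const2)
    show "(\<lambda>l. norm (\<Sum>n\<in>I. star (X k n - X l n) * (X k n - X l n)))
      \<longlonglongrightarrow> norm (\<Sum>n\<in>I. star ((X k - x) n) * (X k - x) n)"
      unfolding fun_diff_def by (intro tendsto_intros tendsto_star x)
    have "norm (\<Sum>n\<in>I. star (X k n - X l n) * (X k n - X l n)) \<le> e\<^sup>2" if "l \<ge> k" for l
    proof -
      have "hnorm (restrict_seq I (X k - X l)) \<le> e"
        using hnorm_restrict_seq_le[OF HA_diff[OF X X], of I k l] k[OF that] by simp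
      then show ?thesis
        using e I by (simp add: hnorm_le_iff hinner_restrict_seq_finite)
    qed
    then show "\<exists>N. \<forall>l\<ge>N. norm (\<Sum>n\<in>I. star (X k n - X l n) * (X k n - X l n)) \<le> e\<^sup>2" by blast
  qed
  have "summable (\<lambda>n. star (x n) * x n)"
    unfolding summable_Cauchy
  proof (intro allI impI)
    fix e :: real assume e: "0 < e"
    define d where "d = sqrt e / 3"
    have d: "0 < d" using e by (simp add: d_def)
    obtain k where k: "\<And>l. l \<ge> k \<Longrightarrow> hnorm (X k - X l) < d"
      using Cauchy[OF d] by blast
    have "summable (\<lambda>n. star (X k n) * X k n)" using X by (simp add: HA_def)
    then obtain N where N: "\<And>m n. m \<ge> N \<Longrightarrow> norm (\<Sum>i=m..<n. star (X k i) * X k i) < d\<^sup>2"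
      unfolding summable_Cauchy using d by (meson zero_less_power)
    have "norm (\<Sum>i=m..<n. star (x i) * x i) < e" if m: "m \<ge> N" for m n
    proof -
      let ?r = "restrict_seq {m..<n}"
      have 1: "hnorm (?r (X k)) \<le> d"
        using N[OF m, of n] d by (simp add: hnorm_le_iff hinner_restrict_seq_finite)
      have 2: "hnorm (?r (X k - x)) \<le> d"
        using close[OF _ d k, of "{m..<n}"] d by (simp add: hnorm_le_iff hinner_restrict_seq_finite)
      have "?r x = ?r (X k) - ?r (X k - x)" by (auto simp: restrict_seq_def)
      then have "hnorm (?r x) \<le> hnorm (?r (X k)) + hnorm (?r (X k - x))"
        by (simp add: hnorm_triangle_diff restrict_seq_finite_HA)
      then have "hnorm (?r x) \<le> 2 * d" using 1 2 by simp
      then have "norm (\<Sum>i=m..<n. star (x i) * x i) \<le> (2 * d)\<^sup>2"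
        using d by (simp add: hnorm_le_iff hinner_restrict_seq_finite)
      also have "\<dots> < e" using e by (simp add: d_def power_mult_distrib power_divide)
      finally show ?thesis .
    qed
    then show "\<exists>N. \<forall>m\<ge>N. \<forall>n. norm (\<Sum>i=m..<n. star (x i) * x i) < e" by blast
  qed
  then have xHA: "x \<in> HA" by (simp add: HA_def)
  have "(\<lambda>k. hnorm (X k - x)) \<longlonglongrightarrow> 0"
  proof (rule LIMSEQ_I)
    fix r :: real assume r: "0 < r"
    then obtain N where N: "\<And>k l. k \<ge> N \<Longrightarrow> l \<ge> N \<Longrightarrow> hnorm (X k - X l) < r / 2"
      using Cauchy[of "r/2"] by auto
    have "hnorm (X k - x) \<le> r / 2" if k: "k \<ge> N" for k
    proof -
      have "norm (hinner (X k - x) (X k - x)) \<le> (r / 2)\<^sup>2"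
      proof (rule LIMSEQ_le_const2)
        have "summable (\<lambda>n. star ((X k - x) n) * (X k - x) n)"
          by (intro summable_hinner HA_diff X xHA)
        from tendsto_norm[OF summable_LIMSEQ[OF this]]
        show "(\<lambda>M. norm (\<Sum>n<M. star ((X k - x) n) * (X k - x) n))
          \<longlonglongrightarrow> norm (hinner (X k - x) (X k - x))"
          unfolding hinner_def .
        have "norm (\<Sum>n<M. star ((X k - x) n) * (X k - x) n) \<le> (r / 2)\<^sup>2" for M
          by (rule close) (use r N k in auto)
        then show "\<exists>N. \<forall>M\<ge>N. norm (\<Sum>n<M. star ((X k - x) n) * (X k - x) n) \<le> (r / 2)\<^sup>2"
          by blast
      qed
      then show ?thesis by (subst hnorm_le_iff) (use r in auto)
    qed
    then show "\<exists>N. \<forall>k\<ge>N. norm (hnorm (X k - x) - 0) < r"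
      using r by (intro exI[of _ N]) force
  qed
  with xHA show ?thesis by blast
qed

text \<open>The standard module as a type, so that theorems about the class \<open>banach\<close> can be applied to it. Real scalars
act through real multiples of the unit.\<close>

typedef (overloaded) 'a hmodule = "HA :: (nat \<Rightarrow> 'a::cstar_algebra) set"
  morphisms seq_of Hm by (rule exI[of _ 0]) simp

setup_lifting type_definition_hmodule

lemma seq_of_HA [simp]: "seq_of x \<in> HA"
  by (rule seq_of)

lemma rmult_add_right: "x \<cdot>\<^sub>A (a + b) = x \<cdot>\<^sub>A a + x \<cdot>\<^sub>A b"
  by (auto simp: rmult_def distrib_left)

lemma rmult_add_left: "(x + y) \<cdot>\<^sub>A a = x \<cdot>\<^sub>A a + y \<cdot>\<^sub>A a"
  by (auto simp: rmult_def distrib_right)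

lemma rmult_rmult: "x \<cdot>\<^sub>A a \<cdot>\<^sub>A b = x \<cdot>\<^sub>A (a * b)"
  by (auto simp: rmult_def mult.assoc)

lemma rmult_one [simp]: "x \<cdot>\<^sub>A 1 = x"
  by (simp add: rmult_def)

lemma rmult_zero_right [simp]: "x \<cdot>\<^sub>A 0 = 0"
  by (auto simp: rmult_def)

lemma rmult_zero_left [simp]: "0 \<cdot>\<^sub>A a = 0"
  by (auto simp: rmult_def)

lemma rmult_minus_one: "x \<cdot>\<^sub>A (- 1) = - x"
  by (auto simp: rmult_def)

lemma rmult_diff_left: "(x - y) \<cdot>\<^sub>A a = x \<cdot>\<^sub>A a - y \<cdot>\<^sub>A a"
  by (auto simp: rmult_def left_diff_distrib)

instantiation hmodule :: (cstar_algebra) real_normed_vector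
begin

lift_definition zero_hmodule :: "'a hmodule" is 0 by (rule HA_zero)
lift_definition plus_hmodule :: "'a hmodule \<Rightarrow> 'a hmodule \<Rightarrow> 'a hmodule" is "(+)" by (rule HA_add)
lift_definition minus_hmodule :: "'a hmodule \<Rightarrow> 'a hmodule \<Rightarrow> 'a hmodule" is "(-)" by (rule HA_diff)
lift_definition uminus_hmodule :: "'a hmodule \<Rightarrow> 'a hmodule" is uminus by (rule HA_minus)
lift_definition scaleR_hmodule :: "real \<Rightarrow> 'a hmodule \<Rightarrow> 'a hmodule" is "\<lambda>r x. x \<cdot>\<^sub>A (r *\<^sub>R 1)"
  by (rule HA_rmult)
lift_definition norm_hmodule :: "'a hmodule \<Rightarrow> real" is hnorm .

definition "dist x y = norm (x - y :: 'a hmodule)"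
definition "sgn x = inverse (norm x) *\<^sub>R (x :: 'a hmodule)"
definition "uniformity = (INF e\<in>{0<..}. principal {(x, y::'a hmodule). dist x y < e})"
definition "open U \<longleftrightarrow> (\<forall>x\<in>U. \<forall>\<^sub>F (x', y) in uniformity. x' = (x::'a hmodule) \<longrightarrow> y \<in> U)"

instance
proof
  fix x y z :: "'a hmodule" and a b :: real and U :: "'a hmodule set"
  show "x + y + z = x + (y + z)" by transfer (simp add: add.assoc)
  show "x + y = y + x" by transfer (simp add: add.commute)
  show "0 + x = x" by transfer simp
  show "- x + x = 0" by transfer simp
  show "x - y = x + - y" by transfer simp
  show "a *\<^sub>R (x + y) = a *\<^sub>R x + a *\<^sub>R y" by transfer (rule rmult_add_left)
  show "(a + b) *\<^sub>R x = a *\<^sub>R x + b *\<^sub>R x"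
    by transfer (simp add: scaleR_add_left rmult_add_right)
  show "a *\<^sub>R b *\<^sub>R x = (a * b) *\<^sub>R x" by transfer (simp add: rmult_rmult mult.commute)
  show "1 *\<^sub>R x = x" by transfer simp
  show "norm x = 0 \<longleftrightarrow> x = 0" by transfer (rule hnorm_eq_zero_iff)
  show "norm (x + y) \<le> norm x + norm y" by transfer (rule hnorm_triangle)
  show "norm (a *\<^sub>R x) = \<bar>a\<bar> * norm x" by transfer (rule hnorm_rmult_real)
qed (simp_all only: dist_hmodule_def sgn_hmodule_def uniformity_hmodule_def open_hmodule_def)

end

instance hmodule :: (cstar_algebra) banach
proof
  fix X :: "nat \<Rightarrow> 'a hmodule" assume X: "Cauchy X"
  have "\<exists>x\<in>HA. (\<lambda>k. hnorm (seq_of (X k) - x)) \<longlonglongrightarrow> 0"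
  proof (rule HA_complete)
    fix e :: real assume "0 < e"
    then show "\<exists>N. \<forall>k\<ge>N. \<forall>l\<ge>N. hnorm (seq_of (X k) - seq_of (X l)) < e"
      using X by (simp add: Cauchy_def dist_norm norm_hmodule.rep_eq minus_hmodule.rep_eq)
  qed simp
  then obtain x where "x \<in> HA" "(\<lambda>k. hnorm (seq_of (X k) - x)) \<longlonglongrightarrow> 0" by blast
  then have "(\<lambda>k. norm (X k - Hm x)) \<longlonglongrightarrow> 0"
    by (simp add: norm_hmodule.rep_eq minus_hmodule.rep_eq Hm_inverse)
  then have "X \<longlonglongrightarrow> Hm x"
    by (rule LIM_zero_cancel[OF tendsto_norm_zero_cancel])
  then show "convergent X" by (auto simp: convergent_def)
qed

section \<open>Complementary subspaces and surjectivity in Banach spaces\<close>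

text \<open>Method of continuity. If \<open>B + t\<close> is onto, its inverse has norm at most \<open>1 / c\<close>, so \<open>B + s\<close> is onto for
\<open>\<bar>s - t\<bar> \<le> c / 2\<close> by the contraction principle. The step length does not depend on \<open>t\<close>, and \<open>B + t\<close> is
onto for large \<open>t\<close>, again by contraction, so finitely many steps lead down to \<open>t = 0\<close>.\<close>

proposition surj_of_bounded_below_translates:
  fixes B :: "'b::banach \<Rightarrow> 'b"
  assumes B: "bounded_linear B" and c: "0 < c"
    and below: "\<And>t x. 0 \<le> t \<Longrightarrow> c * norm x \<le> norm (B x + t *\<^sub>R x)"
  shows "surj B"
proof -
  interpret B: bounded_linear B by (rule B)
  define S where "S t \<longleftrightarrow> surj (\<lambda>x. B x + t *\<^sub>R x)" for t
  have step: "S s" if t: "0 \<le> t" "S t" and st: "\<bar>s - t\<bar> \<le> c / 2" for s t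
  proof -
    define R where "R = inv (\<lambda>x. B x + t *\<^sub>R x)"
    have R: "B (R z) + t *\<^sub>R R z = z" for z
      using t surj_f_inv_f[of "\<lambda>x. B x + t *\<^sub>R x" z] by (simp add: S_def R_def)
    have R_lip: "c * norm (R z - R w) \<le> norm (z - w)" for z w
    proof -
      have "B (R z - R w) + t *\<^sub>R (R z - R w) = (B (R z) + t *\<^sub>R R z) - (B (R w) + t *\<^sub>R R w)"
        by (simp add: B.diff scaleR_diff_right)
      also have "\<dots> = z - w" by (simp only: R)
      finally show ?thesis using below[OF t(1), of "R z - R w"] by simp
    qed
    show ?thesis
      unfolding S_def surj_def
    proof
      fix y
      have "\<exists>!x. R (y - (s - t) *\<^sub>R x) = x"
      proof (rule banach_fix_type)
        have "dist (R (y - (s - t) *\<^sub>R x)) (R (y - (s - t) *\<^sub>R x')) \<le> (1/2) * dist x x'" for x x'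
        proof -
          have "c * norm (R (y - (s - t) *\<^sub>R x) - R (y - (s - t) *\<^sub>R x'))
            \<le> norm ((s - t) *\<^sub>R (x' - x))"
            using R_lip[of "y - (s - t) *\<^sub>R x" "y - (s - t) *\<^sub>R x'"] by (simp add: algebra_simps)
          also have "\<dots> \<le> (c / 2) * norm (x - x')"
            unfolding norm_scaleR norm_minus_commute[of x' x]
            using st by (intro mult_right_mono) auto
          finally show ?thesis using c by (simp add: dist_norm)
        qed
        then show "\<forall>x x'. dist (R (y - (s - t) *\<^sub>R x)) (R (y - (s - t) *\<^sub>R x')) \<le> (1/2) * dist x x'"
          by blast
      qed simp_all
      then obtain x where "R (y - (s - t) *\<^sub>R x) = x" by blast
      with R[of "y - (s - t) *\<^sub>R x"] have "B x + t *\<^sub>R x = y - (s - t) *\<^sub>R x" by simp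
      then have "y = B x + s *\<^sub>R x" by (simp add: algebra_simps)
      then show "\<exists>x. y = B x + s *\<^sub>R x" by blast
    qed
  qed
  obtain K where K: "0 < K" "\<And>x. norm (B x) \<le> norm x * K"
    using B.pos_bounded by blast
  have start: "S (2 * K)"
    unfolding S_def surj_def
  proof
    fix y
    have "\<exists>!x. (1 / (2 * K)) *\<^sub>R (y - B x) = x"
    proof (rule banach_fix_type)
      have "dist ((1 / (2 * K)) *\<^sub>R (y - B x)) ((1 / (2 * K)) *\<^sub>R (y - B x')) \<le> (1/2) * dist x x'" for x x'
      proof -
        have "(1 / (2 * K)) *\<^sub>R (y - B x) - (1 / (2 * K)) *\<^sub>R (y - B x') = (1 / (2 * K)) *\<^sub>R B (x' - x)"
          by (simp add: B.diff scaleR_diff_right)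
        then show ?thesis
          using K(1) K(2)[of "x' - x"] by (simp add: dist_norm norm_minus_commute field_simps)
      qed
      then show "\<forall>x x'. dist ((1 / (2 * K)) *\<^sub>R (y - B x)) ((1 / (2 * K)) *\<^sub>R (y - B x')) \<le> (1/2) * dist x x'"
        by blast
    qed simp_all
    then obtain x where x: "(1 / (2 * K)) *\<^sub>R (y - B x) = x" by blast
    have "y - B x = (2 * K) *\<^sub>R ((1 / (2 * K)) *\<^sub>R (y - B x))" using K by simp
    then have "y - B x = (2 * K) *\<^sub>R x" unfolding x .
    then have "y = B x + (2 * K) *\<^sub>R x" by (simp add: algebra_simps)
    then show "\<exists>x. y = B x + (2 * K) *\<^sub>R x" by blast
  qed
  define d where "d = c / 2"
  have d: "0 < d" using c by (simp add: d_def)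
  have down: "S (max 0 (2 * K - real n * d))" for n
  proof (induction n)
    case 0
    then show ?case using start K by simp
  next
    case (Suc n)
    show ?case
    proof (rule step[OF _ Suc])
      have "real (Suc n) * d = real n * d + d" by (simp add: distrib_right)
      then show "\<bar>max 0 (2 * K - real (Suc n) * d) - max 0 (2 * K - real n * d)\<bar> \<le> c / 2"
        unfolding d_def[symmetric] using d by linarith
    qed simp
  qed
  obtain n where "2 * K < real n * d"
    using reals_Archimedean3[OF d] by blast
  then have "S 0" using down[of n] by (simp add: max_def split: if_splits)
  then show ?thesis by (simp add: S_def)
qed

text \<open>The open mapping argument, carried out for addition \<open>M \<times> N \<rightarrow> M + N\<close>. By Baire's theorem the sums \<open>m + n\<close>
with \<open>norm m \<le> k\<close> are dense in some ball for some \<open>k\<close>. Hence every \<open>y\<close> can be approximated within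
\<open>norm y / 2\<close> by such a sum with \<open>norm m \<le> D * norm y\<close>. Iterating on the remainders, the components in \<open>M\<close> add
up to a vector of norm at most \<open>2 * D * norm y\<close>; as both subspaces are closed, it is the component of \<open>y\<close>.\<close>

proposition complementary_subspaces_bounded:
  fixes M N :: "'b::banach set"
  assumes M: "subspace M" "closed M" and N: "subspace N" "closed N"
    and MN: "M \<inter> N = {0}" and sum: "\<And>x. \<exists>m\<in>M. \<exists>n\<in>N. x = m + n"
  shows "\<exists>C. \<forall>m\<in>M. \<forall>n\<in>N. norm m \<le> C * norm (m + n)"
proof -
  define A where "A k = {m + n | m n. m \<in> M \<and> n \<in> N \<and> norm m \<le> k}" for k :: real
  have UA: "(\<Union>T\<in>range (\<lambda>k::nat. closure (A k)). T) = UNIV"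
  proof -
    have "x \<in> (\<Union>T\<in>range (\<lambda>k::nat. closure (A k)). T)" for x
    proof -
      obtain m n where mn: "m \<in> M" "n \<in> N" "x = m + n" using sum by blast
      obtain k :: nat where "norm m \<le> k" using real_arch_simple by blast
      then have "x \<in> A k" using mn by (auto simp: A_def)
      then have "x \<in> closure (A k)" using closure_subset by blast
      then show ?thesis by blast
    qed
    then show ?thesis by blast
  qed
  have "\<exists>k::nat. interior (closure (A k)) \<noteq> {}"
  proof (rule ccontr)
    assume "\<not> ?thesis"
    then have "euclidean interior_of (\<Union>(range (\<lambda>k::nat. closure (A k)))) = {}"
      by (intro Baire_category_alt) (auto simp: completely_metrizable_space_euclidean)
    then show False using UA by simp
  qed
  then obtain k :: nat and x0 where "x0 \<in> interior (closure (A k))" by blast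
  then obtain r where r: "0 < r" and ball: "ball x0 r \<subseteq> closure (A k)"
    using mem_interior by blast
  \<comment> \<open>Differences of points near \<open>x0\<close> move the ball to the origin, at the price of a factor 2.\<close>
  have near0: "\<exists>m\<in>M. \<exists>n\<in>N. norm m \<le> 2 * k \<and> norm (y - m - n) < e" if y: "norm y < r" and e: "0 < e" for y e
  proof -
    have "x0 + y \<in> closure (A k)" "x0 \<in> closure (A k)"
      using ball r y by (auto simp: subset_iff dist_norm)
    then obtain a b where a: "a \<in> A k" "dist a (x0 + y) < e / 2" and b: "b \<in> A k" "dist b x0 < e / 2"
      using e closure_approachable by (meson half_gt_zero)
    then obtain m n m' n' where mn: "a = m + n" "m \<in> M" "n \<in> N" "norm m \<le> k"
      and mn': "b = m' + n'" "m' \<in> M" "n' \<in> N" "norm m' \<le> k" by (auto simp: A_def)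
    have "norm (m - m') \<le> 2 * k" using norm_triangle_ineq4[of m m'] mn mn' by linarith
    moreover have "norm (y - (m - m') - (n - n')) < e"
    proof -
      have "y - (m - m') - (n - n') = (b - x0) - (a - (x0 + y))" by (simp add: mn mn')
      then have "norm (y - (m - m') - (n - n')) \<le> norm (b - x0) + norm (a - (x0 + y))"
        using norm_triangle_ineq4 by metis
      then show ?thesis using a b by (simp add: dist_norm)
    qed
    ultimately show ?thesis using subspace_diff[OF M(1) mn(2) mn'(2)] subspace_diff[OF N(1) mn(3) mn'(3)] by blast
  qed
  define D where "D = 4 * k / r"
  have D: "0 \<le> D" using r by (simp add: D_def)
  have near: "\<exists>m n. m \<in> M \<and> n \<in> N \<and> norm m \<le> D * norm y \<and> norm (y - m - n) \<le> norm y / 2" for y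
  proof (cases "y = 0")
    case True
    then show ?thesis using subspace_0[OF M(1)] subspace_0[OF N(1)] by (intro exI[of _ 0]) simp
  next
    case False
    define q where "q = r / (2 * norm y)"
    have q: "0 < q" using False r by (simp add: q_def)
    have "norm (q *\<^sub>R y) < r" using False r by (simp add: q_def)
    moreover have "0 < q * (norm y / 2)" using q False by simp
    ultimately obtain m n where mn: "m \<in> M" "n \<in> N" "norm m \<le> 2 * k"
      "norm (q *\<^sub>R y - m - n) < q * (norm y / 2)"
      using near0 by blast
    have "norm ((1/q) *\<^sub>R m) \<le> D * norm y"
      using q mn(3) False r by (simp add: q_def D_def field_simps)
    moreover have "norm (y - (1/q) *\<^sub>R m - (1/q) *\<^sub>R n) \<le> norm y / 2"
    proof -
      have "y - (1/q) *\<^sub>R m - (1/q) *\<^sub>R n = (1/q) *\<^sub>R (q *\<^sub>R y - m - n)"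
        using q by (simp add: scaleR_diff_right)
      then have "norm (y - (1/q) *\<^sub>R m - (1/q) *\<^sub>R n) = (1/q) * norm (q *\<^sub>R y - m - n)"
        using q by simp
      also have "\<dots> \<le> (1/q) * (q * (norm y / 2))" using q mn(4) by (intro mult_left_mono) auto
      finally show ?thesis using q by simp
    qed
    ultimately show ?thesis using subspace_scale[OF M(1) mn(1)] subspace_scale[OF N(1) mn(2)] by blast
  qed
  then obtain f g where f: "\<And>y. f y \<in> M" and g: "\<And>y. g y \<in> N"
    and fD: "\<And>y. norm (f y) \<le> D * norm y" and fg: "\<And>y. norm (y - f y - g y) \<le> norm y / 2"
    by metis
  have "norm m \<le> 2 * D * norm (m + n)" if mn: "m \<in> M" "n \<in> N" for m n
  proof -
    define y where "y = m + n"
    define z where "z i = ((\<lambda>y. y - f y - g y) ^^ i) y" for i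
    have z0: "z 0 = y" and zSuc: "z (Suc i) = z i - f (z i) - g (z i)" for i by (simp_all add: z_def)
    have z_le: "norm (z i) \<le> norm y * (1/2) ^ i" for i
    proof (induction i)
      case (Suc i)
      have "norm (z (Suc i)) \<le> norm (z i) / 2" unfolding zSuc by (rule fg)
      then show ?case using Suc by simp
    qed (simp add: z0)
    have geo: "(\<lambda>i. D * norm y * (1/2) ^ i) sums (D * norm y * 2)"
      using geometric_sums[of "1/2::real"] by (intro sums_mult) simp
    have f_le: "norm (f (z i)) \<le> D * norm y * (1/2) ^ i" for i
      using fD[of "z i"] mult_left_mono[OF z_le[of i] D] by (simp add: mult.assoc)
    have "summable (\<lambda>i. f (z i))"
      by (rule summable_comparison_test'[OF sums_summable[OF geo]]) (rule f_le)
    then have s: "(\<lambda>j. \<Sum>i<j. f (z i)) \<longlonglongrightarrow> (\<Sum>i. f (z i))" by (rule summable_LIMSEQ)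
    define s where "s = (\<Sum>i. f (z i))"
    have s_le: "norm s \<le> 2 * D * norm y"
      using norm_suminf_le[OF f_le sums_summable[OF geo]] sums_unique[OF geo] by (simp add: s_def mult_ac)
    have sM: "s \<in> M"
      unfolding s_def
      by (rule closed_sequentially[OF M(2) _ s]) (intro subspace_sum[OF M(1)] f)
    \<comment> \<open>The partial sums of the components in \<open>N\<close> converge, being differences of convergent sequences.\<close>
    have gsum: "(\<Sum>i<j. g (z i)) = y - z j - (\<Sum>i<j. f (z i))" for j
      by (induction j) (simp_all add: z0 zSuc algebra_simps)
    have "(\<lambda>j. norm y * (1/2) ^ j) \<longlonglongrightarrow> norm y * 0"
      by (intro tendsto_intros LIMSEQ_realpow_zero) simp_all
    then have "z \<longlonglongrightarrow> 0"
      by (intro Lim_null_comparison[of z "\<lambda>j. norm y * (1/2) ^ j"]) (simp_all add: z_le)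
    then have "(\<lambda>j. \<Sum>i<j. g (z i)) \<longlonglongrightarrow> y - 0 - s"
      unfolding gsum s_def by (intro tendsto_intros s)
    then have sN: "y - s \<in> N"
      using closed_sequentially[OF N(2)] subspace_sum[OF N(1)] g by (metis diff_zero)
    have "m - s = (y - s) - n" by (simp add: y_def)
    then have "m - s \<in> M \<inter> N"
      using subspace_diff[OF M(1) mn(1) sM] subspace_diff[OF N(1) sN mn(2)] by (metis IntI)
    then have "m = s" using MN by simp
    then show ?thesis using s_le by (simp add: y_def)
  qed
  then show ?thesis by blast
qed

section \<open>Submodules, decompositions and module maps\<close>

lemma closed_submodule_diff:
  assumes "closed_submodule M" "x \<in> M" "y \<in> M" shows "x - y \<in> M"
proof -
  have "x + y \<cdot>\<^sub>A (- 1) \<in> M" using assms by (simp add: closed_submodule_def)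
  then show ?thesis by (simp add: rmult_minus_one)
qed

lemma closed_submodule_minus: "closed_submodule M \<Longrightarrow> x \<in> M \<Longrightarrow> - x \<in> M"
  using closed_submodule_diff[of M 0 x] by (simp add: closed_submodule_def)

lemma closed_submodule_sum:
  assumes "closed_submodule M" "\<And>i. i \<in> I \<Longrightarrow> f i \<in> M"
  shows "sum f I \<in> M"
  using assms(2)
  by (induction I rule: infinite_finite_induct) (use assms(1) in \<open>auto simp: closed_submodule_def\<close>)

lemma decompositionE:
  assumes "decomposition M N" "x \<in> HA"
  obtains m n where "m \<in> M" "n \<in> N" "x = m + n"
proof -
  have "x \<in> {x + y | x y. x \<in> M \<and> y \<in> N}" using assms by (simp add: decomposition_def)
  then show thesis using that by blast
qed

text \<open>This is where two closed submodules with algebraic direct sum \<open>HA\<close> acquire a topological one: on the type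
\<open>hmodule\<close> they are closed complementary subspaces of a Banach space.\<close>

proposition decomposition_bounded:
  assumes "decomposition M N"
  obtains C where "0 < C" "\<And>m n. m \<in> M \<Longrightarrow> n \<in> N \<Longrightarrow> hnorm m \<le> C * hnorm (m + n)"
proof -
  have MN: "closed_submodule M" "closed_submodule N" "M \<inter> N = {0}"
    using assms by (auto simp: decomposition_def)
  have sub: "subspace (seq_of -` K)" "closed (seq_of -` K)" if K: "closed_submodule K" for K
  proof -
    show "subspace (seq_of -` K)"
      using K by (auto simp: subspace_def closed_submodule_def zero_hmodule.rep_eq plus_hmodule.rep_eq
          scaleR_hmodule.rep_eq)
    show "closed (seq_of -` K)"
      unfolding closed_sequential_limits
    proof (intro allI impI)
      fix X l assume X: "(\<forall>n. X n \<in> seq_of -` K) \<and> X \<longlonglongrightarrow> l"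
      then have "(\<lambda>k. norm (X k - l)) \<longlonglongrightarrow> 0" by (simp add: LIM_zero_iff tendsto_norm_zero_iff)
      then have "(\<lambda>k. hnorm (seq_of (X k) - seq_of l)) \<longlonglongrightarrow> 0"
        by (simp add: norm_hmodule.rep_eq minus_hmodule.rep_eq)
      moreover have "\<forall>Y. \<forall>x\<in>HA. (\<forall>k. Y k \<in> K) \<and> (\<lambda>k. hnorm (Y k - x)) \<longlonglongrightarrow> 0 \<longrightarrow> x \<in> K"
        using K by (simp add: closed_submodule_def)
      ultimately show "l \<in> seq_of -` K"
        using X by (metis seq_of_HA vimage_eq)
    qed
  qed
  have "\<exists>C. \<forall>m\<in>seq_of -` M. \<forall>n\<in>seq_of -` N. norm m \<le> C * norm (m + n)"
  proof (rule complementary_subspaces_bounded)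
    show "seq_of -` M \<inter> seq_of -` N = {0}"
    proof (rule set_eqI)
      fix x show "x \<in> seq_of -` M \<inter> seq_of -` N \<longleftrightarrow> x \<in> {0}"
        using MN(3) by (auto simp: set_eq_iff zero_hmodule.rep_eq simp flip: seq_of_inject)
    qed
    show "\<exists>m\<in>seq_of -` M. \<exists>n\<in>seq_of -` N. x = m + n" for x
    proof -
      obtain m n where mn: "m \<in> M" "n \<in> N" "seq_of x = m + n"
        using decompositionE[OF assms seq_of_HA] by metis
      have HA: "m \<in> HA" "n \<in> HA" using mn MN by (auto simp: closed_submodule_def)
      have "x = Hm m + Hm n"
        using mn HA by (simp add: plus_hmodule.rep_eq Hm_inverse flip: seq_of_inject)
      then show ?thesis using mn HA by (intro bexI[of _ "Hm m"] bexI[of _ "Hm n"]) (auto simp: Hm_inverse)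
    qed
  qed (use sub MN in auto)
  then obtain C where C: "\<And>m n. m \<in> seq_of -` M \<Longrightarrow> n \<in> seq_of -` N \<Longrightarrow> norm m \<le> C * norm (m + n)"
    by blast
  show thesis
  proof
    show "hnorm m \<le> (\<bar>C\<bar> + 1) * hnorm (m + n)" if "m \<in> M" "n \<in> N" for m n
    proof -
      have HA: "m \<in> HA" "n \<in> HA" using that MN by (auto simp: closed_submodule_def)
      have "hnorm m \<le> C * hnorm (m + n)"
        using C[of "Hm m" "Hm n"] that HA by (simp add: norm_hmodule.rep_eq plus_hmodule.rep_eq Hm_inverse)
      also have "\<dots> \<le> (\<bar>C\<bar> + 1) * hnorm (m + n)" by (intro mult_right_mono) auto
      finally show ?thesis .
    qed
  qed simp
qed

lemma decomposition_unique:
  assumes "decomposition M N" "m \<in> M" "n \<in> N" "m' \<in> M" "n' \<in> N" "m + n = m' + n'"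
  shows "m = m'"
proof -
  have MN: "closed_submodule M" "closed_submodule N" "M \<inter> N = {0}"
    using assms by (auto simp: decomposition_def)
  have "m - m' = n' - n" using assms(6) by (metis add_diff_cancel_left add.commute diff_add_cancel add_diff_eq)
  then have "m - m' \<in> M \<inter> N"
    using closed_submodule_diff[OF MN(1) assms(2,4)] closed_submodule_diff[OF MN(2) assms(5,3)] by simp
  then show ?thesis using MN(3) by simp
qed

lemma proj_along_eq:
  assumes "decomposition M N" "m \<in> M" "n \<in> N"
  shows "proj_along M N (m + n) = m"
  unfolding proj_along_def
  using assms decomposition_unique[OF assms(1)] by (intro the_equality) blast+

text \<open>Like \<open>Ba\<close>, but without an adjoint: the left inverse constructed below and the idempotents built from it
are maps of this kind.\<close>

definition bounded_module_map :: "((nat \<Rightarrow> 'a::cstar_algebra) \<Rightarrow> nat \<Rightarrow> 'a) \<Rightarrow> bool" where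
  "bounded_module_map T \<longleftrightarrow> T ` HA \<subseteq> HA \<and> A_linear_on HA T \<and> hbounded_on HA T"

lemma hbounded_onE:
  assumes "hbounded_on M T"
  obtains C where "0 < C" "\<And>x. x \<in> M \<Longrightarrow> hnorm (T x) \<le> C * hnorm x"
proof -
  obtain C where C: "\<And>x. x \<in> M \<Longrightarrow> hnorm (T x) \<le> C * hnorm x"
    using assms by (auto simp: hbounded_on_def)
  have "hnorm (T x) \<le> (\<bar>C\<bar> + 1) * hnorm x" if "x \<in> M" for x
    using C[OF that] mult_right_mono[of C "\<bar>C\<bar> + 1" "hnorm x"]
      abs_ge_self[of C] hnorm_nonneg[of x] by linarith
  then show thesis by (intro that[of "\<bar>C\<bar> + 1"]) auto
qed

context
  fixes T :: "(nat \<Rightarrow> 'a::cstar_algebra) \<Rightarrow> nat \<Rightarrow> 'a"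
  assumes T: "bounded_module_map T"
begin

lemma map_HA: "x \<in> HA \<Longrightarrow> T x \<in> HA"
  using T by (auto simp: bounded_module_map_def)

lemma map_add: "x \<in> HA \<Longrightarrow> y \<in> HA \<Longrightarrow> T (x + y) = T x + T y"
  using T by (auto simp: bounded_module_map_def A_linear_on_def)

lemma map_rmult: "x \<in> HA \<Longrightarrow> T (x \<cdot>\<^sub>A a) = T x \<cdot>\<^sub>A a"
  using T by (auto simp: bounded_module_map_def A_linear_on_def)

lemma map_zero: "T 0 = 0"
  using map_rmult[of 0 0] by simp

lemma map_minus: "x \<in> HA \<Longrightarrow> T (- x) = - T x"
  using map_rmult[of x "- 1"] by (simp add: rmult_minus_one)

lemma map_diff: "x \<in> HA \<Longrightarrow> y \<in> HA \<Longrightarrow> T (x - y) = T x - T y"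
  using map_add[of x "- y"] by (simp add: map_minus HA_minus)

lemma map_bounded: obtains C where "0 < C" "\<And>x. x \<in> HA \<Longrightarrow> hnorm (T x) \<le> C * hnorm x"
  using T hbounded_onE[of HA T] by (auto simp: bounded_module_map_def)

lemma closed_submodule_kernel: "closed_submodule (kernel_of T)"
  unfolding closed_submodule_def
proof (intro conjI ballI allI impI)
  fix X x assume x: "x \<in> HA" and X: "(\<forall>k. X k \<in> kernel_of T) \<and> (\<lambda>k. hnorm (X k - x)) \<longlonglongrightarrow> 0"
  obtain C where C: "\<And>x. x \<in> HA \<Longrightarrow> hnorm (T x) \<le> C * hnorm x"
    using map_bounded by blast
  have "hnorm (T x) \<le> C * hnorm (X k - x)" for k
  proof -
    have Xk: "X k \<in> HA" "T (X k) = 0" using X by (auto simp: kernel_of_def)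
    then have "T (X k - x) = - T x" using x by (simp add: map_diff)
    then show ?thesis using C[OF HA_diff[OF Xk(1) x]] by simp
  qed
  moreover have "(\<lambda>k. C * hnorm (X k - x)) \<longlonglongrightarrow> C * 0" using X by (intro tendsto_intros) simp
  ultimately have "hnorm (T x) \<le> C * 0" by (intro LIMSEQ_le_const) auto
  then have "hnorm (T x) = 0" using hnorm_nonneg[of "T x"] by simp
  then show "x \<in> kernel_of T" using x by (simp add: kernel_of_def hnorm_eq_zero_iff map_HA)
qed (auto simp: kernel_of_def map_zero map_add map_rmult HA_add HA_rmult)

end

lemma bounded_module_map_id: "bounded_module_map (\<lambda>x. x)"
  by (auto simp: bounded_module_map_def A_linear_on_def hbounded_on_def intro!: exI[of _ 1])

lemma bounded_module_map_compose:
  assumes S: "bounded_module_map S" and T: "bounded_module_map T"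
  shows "bounded_module_map (\<lambda>x. S (T x))"
proof -
  obtain C where C: "0 < C" "\<And>x. x \<in> HA \<Longrightarrow> hnorm (S x) \<le> C * hnorm x" using map_bounded[OF S] by blast
  obtain D where D: "0 < D" "\<And>x. x \<in> HA \<Longrightarrow> hnorm (T x) \<le> D * hnorm x" using map_bounded[OF T] by blast
  have "hnorm (S (T x)) \<le> (C * D) * hnorm x" if "x \<in> HA" for x
    using C(2)[OF map_HA[OF T that]] mult_left_mono[OF D(2)[OF that], of C] C(1)
    unfolding mult.assoc by linarith
  then show ?thesis
    by (auto simp: bounded_module_map_def A_linear_on_def hbounded_on_def map_HA[OF S] map_HA[OF T]
        map_add[OF S] map_add[OF T] map_rmult[OF S] map_rmult[OF T])
qed

lemma bounded_module_map_add:
  assumes S: "bounded_module_map S" and T: "bounded_module_map T"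
  shows "bounded_module_map (\<lambda>x. S x + T x)"
proof -
  obtain C where C: "\<And>x. x \<in> HA \<Longrightarrow> hnorm (S x) \<le> C * hnorm x" using map_bounded[OF S] by blast
  obtain D where D: "\<And>x. x \<in> HA \<Longrightarrow> hnorm (T x) \<le> D * hnorm x" using map_bounded[OF T] by blast
  have "hnorm (S x + T x) \<le> (C + D) * hnorm x" if "x \<in> HA" for x
    using hnorm_triangle[OF map_HA[OF S that] map_HA[OF T that]] C[OF that] D[OF that]
    by (simp add: distrib_right)
  then show ?thesis
    by (auto simp: bounded_module_map_def A_linear_on_def hbounded_on_def map_HA[OF S] map_HA[OF T] HA_add
        map_add[OF S] map_add[OF T] map_rmult[OF S] map_rmult[OF T] rmult_add_left)
qed

lemma bounded_module_map_diff:
  assumes S: "bounded_module_map S" and T: "bounded_module_map T"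
  shows "bounded_module_map (\<lambda>x. S x - T x)"
proof -
  obtain C where C: "\<And>x. x \<in> HA \<Longrightarrow> hnorm (S x) \<le> C * hnorm x" using map_bounded[OF S] by blast
  obtain D where D: "\<And>x. x \<in> HA \<Longrightarrow> hnorm (T x) \<le> D * hnorm x" using map_bounded[OF T] by blast
  have "hnorm (S x - T x) \<le> (C + D) * hnorm x" if "x \<in> HA" for x
    using hnorm_triangle_diff[OF map_HA[OF S that] map_HA[OF T that]] C[OF that] D[OF that]
    by (simp add: distrib_right)
  then show ?thesis
    by (auto simp: bounded_module_map_def A_linear_on_def hbounded_on_def map_HA[OF S] map_HA[OF T] HA_diff
        map_add[OF S] map_add[OF T] map_rmult[OF S] map_rmult[OF T] rmult_diff_left)
qed

text \<open>The range is closed because it is the kernel of the complementary idempotent \<open>x - Q x\<close>.\<close>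

lemma decomposition_idempotent:
  fixes Q :: "(nat \<Rightarrow> 'a::cstar_algebra) \<Rightarrow> nat \<Rightarrow> 'a"
  assumes Q: "bounded_module_map Q" and QQ: "\<And>x. x \<in> HA \<Longrightarrow> Q (Q x) = Q x"
  shows "decomposition (Q ` HA) (kernel_of Q)"
proof -
  have "closed_submodule (kernel_of (\<lambda>x. x - Q x))"
    by (rule closed_submodule_kernel[OF bounded_module_map_diff[OF bounded_module_map_id Q]])
  also have "kernel_of (\<lambda>x. x - Q x) = Q ` HA"
  proof
    show "kernel_of (\<lambda>x. x - Q x) \<subseteq> Q ` HA" by (auto simp: kernel_of_def image_iff)
    show "Q ` HA \<subseteq> kernel_of (\<lambda>x. x - Q x)"
      using QQ map_HA[OF Q] by (auto simp: kernel_of_def)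
  qed
  finally have range: "closed_submodule (Q ` HA)" .
  show ?thesis
    unfolding decomposition_def
  proof (intro conjI range closed_submodule_kernel Q)
    show "Q ` HA \<inter> kernel_of Q = {0}"
      using QQ map_zero[OF Q] by (auto simp: kernel_of_def image_iff intro: bexI[of _ 0])
    show "HA = {x + y | x y. x \<in> Q ` HA \<and> y \<in> kernel_of Q}"
    proof (intro equalityI subsetI)
      fix x :: "nat \<Rightarrow> 'a" assume x: "x \<in> HA"
      have "x = Q x + (x - Q x)" by simp
      moreover have "x - Q x \<in> kernel_of Q"
        using x by (simp add: kernel_of_def map_diff[OF Q] QQ HA_diff map_HA[OF Q])
      ultimately show "x \<in> {x + y | x y. x \<in> Q ` HA \<and> y \<in> kernel_of Q}" using x by blast
    qed (auto simp: kernel_of_def intro!: HA_add map_HA[OF Q])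
  qed
qed

text \<open>Injectivity lets the coefficients be carried over along \<open>S \<rightarrow> T ` S\<close>: distinct generators keep distinct images,
so no coefficients have to be merged.\<close>

lemma finitely_generated_image:
  assumes M: "closed_submodule M" "finitely_generated M" and T: "A_linear_on M T" "inj_on T M"
  shows "finitely_generated (T ` M)"
proof -
  obtain S where S: "finite S" "S \<subseteq> M" and M_eq: "M = {\<Sum>s\<in>S. s \<cdot>\<^sub>A c s | c. True}"
    using M(2) by (auto simp: finitely_generated_def)
  have sM: "s \<cdot>\<^sub>A a \<in> M" if "s \<in> S" for s a
    using M(1) S that by (auto simp: closed_submodule_def)
  have "0 \<in> M" using M(1) by (simp add: closed_submodule_def)
  then have "T (0 \<cdot>\<^sub>A 0) = T 0 \<cdot>\<^sub>A 0" using T(1) unfolding A_linear_on_def by blast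
  then have T0: "T 0 = 0" by simp
  have T_sum: "T (\<Sum>s\<in>S. s \<cdot>\<^sub>A c s) = (\<Sum>s\<in>S. T s \<cdot>\<^sub>A c s)" for c
    using S
  proof (induction S rule: finite_induct)
    case (insert s S)
    have sc: "s \<cdot>\<^sub>A c s \<in> M" "(\<Sum>s\<in>S. s \<cdot>\<^sub>A c s) \<in> M"
      using insert M(1) by (auto simp: closed_submodule_def intro!: closed_submodule_sum[OF M(1)])
    have "T (s \<cdot>\<^sub>A c s + (\<Sum>s\<in>S. s \<cdot>\<^sub>A c s)) = T (s \<cdot>\<^sub>A c s) + T (\<Sum>s\<in>S. s \<cdot>\<^sub>A c s)"
      using T(1) sc unfolding A_linear_on_def by blast
    moreover have "T (s \<cdot>\<^sub>A c s) = T s \<cdot>\<^sub>A c s"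
      using T(1) insert.prems unfolding A_linear_on_def by blast
    moreover have "T (\<Sum>s\<in>S. s \<cdot>\<^sub>A c s) = (\<Sum>s\<in>S. T s \<cdot>\<^sub>A c s)" using insert by simp
    ultimately show ?case by (simp only: sum.insert[OF insert.hyps])
  qed (simp add: T0)
  have inj: "inj_on T S" using T(2) S(2) by (rule inj_on_subset)
  have reindex: "(\<Sum>t\<in>T ` S. t \<cdot>\<^sub>A c t) = (\<Sum>s\<in>S. T s \<cdot>\<^sub>A c (T s))" for c
    using inj by (simp add: sum.reindex)
  have "T ` M = {\<Sum>t\<in>T ` S. t \<cdot>\<^sub>A c t | c. True}"
  proof (intro equalityI subsetI)
    fix y assume "y \<in> T ` M"
    then obtain c where "y = T (\<Sum>s\<in>S. s \<cdot>\<^sub>A c s)" using M_eq by auto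
    then have "y = (\<Sum>s\<in>S. T s \<cdot>\<^sub>A c s)" by (simp only: T_sum)
    also have "\<dots> = (\<Sum>s\<in>S. T s \<cdot>\<^sub>A c (inv_into S T (T s)))" using inj by (intro sum.cong) auto
    also have "\<dots> = (\<Sum>t\<in>T ` S. t \<cdot>\<^sub>A c (inv_into S T t))" by (rule reindex[symmetric])
    finally show "y \<in> {\<Sum>t\<in>T ` S. t \<cdot>\<^sub>A c t | c. True}"
      by (intro CollectI exI[of _ "\<lambda>t. c (inv_into S T t)"] conjI) simp_all
  next
    fix y assume "y \<in> {\<Sum>t\<in>T ` S. t \<cdot>\<^sub>A c t | c. True}"
    then obtain c where "y = (\<Sum>s\<in>S. T s \<cdot>\<^sub>A c (T s))" by (auto simp: reindex)
    then have "y = T (\<Sum>s\<in>S. s \<cdot>\<^sub>A c (T s))" by (simp only: T_sum)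
    moreover have "(\<Sum>s\<in>S. s \<cdot>\<^sub>A c (T s)) \<in> M" by (rule closed_submodule_sum[OF M(1) sM])
    ultimately show "y \<in> T ` M" by (rule image_eqI)
  qed
  moreover have "finite (T ` S)" "T ` S \<subseteq> T ` M" using S by auto
  ultimately show ?thesis unfolding finitely_generated_def by (intro exI[of _ "T ` S"] conjI)
qed

lemma A_linear_on_inv_into:
  assumes M: "closed_submodule M" and T: "A_linear_on M T" "bij_betw T M N"
  shows "A_linear_on N (inv_into M T)"
proof -
  have inj: "inj_on T M" and N: "N = T ` M" using T(2) by (auto simp: bij_betw_def)
  have "inv_into M T (T x + T y) = x + y" if "x \<in> M" "y \<in> M" for x y
    using inv_into_f_f[OF inj, of "x + y"] that T(1) M by (auto simp: A_linear_on_def closed_submodule_def)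
  moreover have "inv_into M T (T x \<cdot>\<^sub>A a) = x \<cdot>\<^sub>A a" if "x \<in> M" for x a
    using inv_into_f_f[OF inj, of "x \<cdot>\<^sub>A a"] that T(1) M by (auto simp: A_linear_on_def closed_submodule_def)
  ultimately show ?thesis using inj by (auto simp: N A_linear_on_def)
qed

section \<open>Adjointable operators and left inverses\<close>

lemma Ba_bounded_module_map: "T \<in> Ba \<Longrightarrow> bounded_module_map T"
  by (auto simp: Ba_def bounded_module_map_def)

lemma BaI:
  assumes "bounded_module_map T" "\<And>x. x \<in> HA \<Longrightarrow> S x \<in> HA"
    "\<And>x y. x \<in> HA \<Longrightarrow> y \<in> HA \<Longrightarrow> hinner (T x) y = hinner x (S y)"
  shows "T \<in> Ba"
  using assms by (auto simp: Ba_def bounded_module_map_def)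

lemma BaE:
  assumes "T \<in> Ba"
  obtains S where "bounded_module_map T" "\<And>x. x \<in> HA \<Longrightarrow> S x \<in> HA"
    "\<And>x y. x \<in> HA \<Longrightarrow> y \<in> HA \<Longrightarrow> hinner (T x) y = hinner x (S y)"
proof -
  obtain S where "S ` HA \<subseteq> HA" "\<forall>x\<in>HA. \<forall>y\<in>HA. hinner (T x) y = hinner x (S y)"
    using assms by (auto simp: Ba_def)
  then show thesis using that[of S] Ba_bounded_module_map[OF assms] by blast
qed

lemma Ba_id: "(\<lambda>x. x) \<in> Ba"
  by (rule BaI[of _ "\<lambda>x. x"]) (simp_all add: bounded_module_map_id)

lemma Ba_compose: assumes S: "S \<in> Ba" and T: "T \<in> Ba" shows "(\<lambda>x. S (T x)) \<in> Ba"
proof -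
  obtain S' where S': "bounded_module_map S" "\<And>x. x \<in> HA \<Longrightarrow> S' x \<in> HA"
    "\<And>x y. x \<in> HA \<Longrightarrow> y \<in> HA \<Longrightarrow> hinner (S x) y = hinner x (S' y)" using BaE[OF S] by blast
  obtain T' where T': "bounded_module_map T" "\<And>x. x \<in> HA \<Longrightarrow> T' x \<in> HA"
    "\<And>x y. x \<in> HA \<Longrightarrow> y \<in> HA \<Longrightarrow> hinner (T x) y = hinner x (T' y)" using BaE[OF T] by blast
  show ?thesis
    by (rule BaI[of _ "\<lambda>x. T' (S' x)"])
      (simp_all add: S' T' bounded_module_map_compose map_HA[OF T'(1)])
qed

lemma Ba_add: assumes S: "S \<in> Ba" and T: "T \<in> Ba" shows "(\<lambda>x. S x + T x) \<in> Ba"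
proof -
  obtain S' where S': "bounded_module_map S" "\<And>x. x \<in> HA \<Longrightarrow> S' x \<in> HA"
    "\<And>x y. x \<in> HA \<Longrightarrow> y \<in> HA \<Longrightarrow> hinner (S x) y = hinner x (S' y)" using BaE[OF S] by blast
  obtain T' where T': "bounded_module_map T" "\<And>x. x \<in> HA \<Longrightarrow> T' x \<in> HA"
    "\<And>x y. x \<in> HA \<Longrightarrow> y \<in> HA \<Longrightarrow> hinner (T x) y = hinner x (T' y)" using BaE[OF T] by blast
  show ?thesis
    by (rule BaI[of _ "\<lambda>x. S' x + T' x"])
      (simp_all add: S' T' bounded_module_map_add HA_add hinner_add_left hinner_add_right
        map_HA[OF S'(1)] map_HA[OF T'(1)])
qed

lemma Ba_diff: assumes S: "S \<in> Ba" and T: "T \<in> Ba" shows "(\<lambda>x. S x - T x) \<in> Ba"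
proof -
  obtain S' where S': "bounded_module_map S" "\<And>x. x \<in> HA \<Longrightarrow> S' x \<in> HA"
    "\<And>x y. x \<in> HA \<Longrightarrow> y \<in> HA \<Longrightarrow> hinner (S x) y = hinner x (S' y)" using BaE[OF S] by blast
  obtain T' where T': "bounded_module_map T" "\<And>x. x \<in> HA \<Longrightarrow> T' x \<in> HA"
    "\<And>x y. x \<in> HA \<Longrightarrow> y \<in> HA \<Longrightarrow> hinner (T x) y = hinner x (T' y)" using BaE[OF T] by blast
  show ?thesis
    by (rule BaI[of _ "\<lambda>x. S' x - T' x"])
      (simp_all add: S' T' bounded_module_map_diff HA_diff hinner_diff_left hinner_diff_right
        map_HA[OF S'(1)] map_HA[OF T'(1)])
qed

text \<open>Centrality is used twice: \<open>x \<mapsto> x \<cdot>\<^sub>A \<alpha>\<close> is \<open>A\<close>-linear only because \<open>\<alpha>\<close> commutes with the algebra, and the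
adjoint is multiplication by \<open>star \<alpha>\<close> only because that is central as well.\<close>

lemma Ba_rmult_central:
  assumes "\<alpha> \<in> center" shows "(\<lambda>x. x \<cdot>\<^sub>A \<alpha>) \<in> Ba"
proof -
  have c: "\<alpha> * b = b * \<alpha>" for b using assms by (simp add: center_def)
  have sc: "star \<alpha> * b = b * star \<alpha>" for b
    using arg_cong[OF c[of "star b"], of star] by (simp add: star_mult star_star)
  have swap: "x \<cdot>\<^sub>A a \<cdot>\<^sub>A \<alpha> = x \<cdot>\<^sub>A \<alpha> \<cdot>\<^sub>A a" for x :: "nat \<Rightarrow> 'a" and a
    by (simp add: rmult_rmult c)
  show ?thesis
  proof (rule BaI[of _ "\<lambda>x. x \<cdot>\<^sub>A star \<alpha>"])
    show "bounded_module_map (\<lambda>x. x \<cdot>\<^sub>A \<alpha>)"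
      using hnorm_rmult_le[of _ \<alpha>]
      by (auto simp: bounded_module_map_def A_linear_on_def hbounded_on_def HA_rmult rmult_add_left swap)
  qed (simp_all add: HA_rmult hinner_rmult_left hinner_rmult_right sc)
qed

lemma Ba_cong:
  assumes "T \<in> Ba" "\<And>x. x \<in> HA \<Longrightarrow> T' x = T x" shows "T' \<in> Ba"
proof -
  have "x + y \<in> HA" if "x \<in> HA" "y \<in> HA" for x y :: "nat \<Rightarrow> 'a" using that by (rule HA_add)
  with assms show ?thesis
    by (auto simp: Ba_def A_linear_on_def hbounded_on_def HA_rmult)
qed

lemma hinner_cancel_left:
  assumes "u \<in> HA" "v \<in> HA" "\<And>x. x \<in> HA \<Longrightarrow> hinner x u = hinner x v"
  shows "u = v"
proof -
  have "hinner (u - v) (u - v) = 0" using assms by (simp add: hinner_diff_right HA_diff)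
  then have "hnorm (u - v) = 0" by (simp add: hnorm_def)
  then show ?thesis using assms by (simp add: hnorm_eq_zero_iff HA_diff)
qed

text \<open>Linearity holds because the inner product separates points, and the bound because
\<open>(hnorm (T' y))\<^sup>2\<close> is the norm of \<open>\<langle>T (T' y), y\<rangle>\<close>.\<close>

lemma bounded_module_map_adjoint:
  assumes T: "bounded_module_map T" and T'_HA: "\<And>x. x \<in> HA \<Longrightarrow> T' x \<in> HA"
    and adj: "\<And>x y. x \<in> HA \<Longrightarrow> y \<in> HA \<Longrightarrow> hinner (T x) y = hinner x (T' y)"
  shows "bounded_module_map T'"
proof -
  have add: "T' (x + y) = T' x + T' y" if "x \<in> HA" "y \<in> HA" for x y
    using that by (intro hinner_cancel_left) (simp_all add: T'_HA HA_add hinner_add_right map_HA[OF T] flip: adj)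
  have rmult: "T' (x \<cdot>\<^sub>A a) = T' x \<cdot>\<^sub>A a" if "x \<in> HA" for x a
    using that by (intro hinner_cancel_left) (simp_all add: T'_HA HA_rmult hinner_rmult_right map_HA[OF T] flip: adj)
  obtain C where C: "0 < C" "\<And>x. x \<in> HA \<Longrightarrow> hnorm (T x) \<le> C * hnorm x" using map_bounded[OF T] by blast
  have "hnorm (T' y) \<le> C * hnorm y" if y: "y \<in> HA" for y
  proof (cases "hnorm (T' y) = 0")
    case False
    have "hnorm (T' y) * hnorm (T' y) = norm (hinner (T (T' y)) y)"
      using y hnorm_square[of "T' y"] by (simp add: adj T'_HA power2_eq_square)
    also have "\<dots> \<le> hnorm (T (T' y)) * hnorm y"
      by (intro hinner_Cauchy_Schwarz map_HA[OF T] T'_HA y)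
    also have "\<dots> \<le> C * hnorm (T' y) * hnorm y"
      by (intro mult_right_mono C T'_HA y) simp
    also have "\<dots> = hnorm (T' y) * (C * hnorm y)" by simp
    finally show ?thesis using False hnorm_nonneg[of "T' y"] by (simp add: mult_le_cancel_left)
  qed (use C in simp)
  then show ?thesis using add rmult T'_HA
    by (auto simp: bounded_module_map_def A_linear_on_def hbounded_on_def)
qed

text \<open>With \<open>B = T' T\<close>, where \<open>T'\<close> is the adjoint, Cauchy-Schwarz gives \<open>c\<^sup>2 * hnorm x \<le> hnorm (B x)\<close>. For \<open>t \<ge> 0\<close> the
difference \<open>\<langle>(B + t) x, (B + t) x\<rangle> - \<langle>B x, B x\<rangle> = 2 t \<langle>T x, T x\<rangle> + t\<^sup>2 \<langle>x, x\<rangle>\<close> is positive, so \<open>B + t\<close> has the same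
lower bound and \<open>B\<close> is bijective. Then \<open>L y\<close> is the solution \<open>x\<close> of \<open>B x = T' y\<close>.\<close>

proposition bounded_below_left_inverse:
  assumes "T \<in> Ba" and below: "bounded_below_on HA T"
  obtains L where "bounded_module_map L" "\<And>x. x \<in> HA \<Longrightarrow> L (T x) = x"
proof -
  obtain T' where T: "bounded_module_map T" and T'_HA: "\<And>x. x \<in> HA \<Longrightarrow> T' x \<in> HA"
    and adj: "\<And>x y. x \<in> HA \<Longrightarrow> y \<in> HA \<Longrightarrow> hinner (T x) y = hinner x (T' y)" using BaE[OF assms(1)] by blast
  have T': "bounded_module_map T'" by (rule bounded_module_map_adjoint[OF T T'_HA adj])
  obtain c where c: "0 < c" "\<And>x. x \<in> HA \<Longrightarrow> c * hnorm x \<le> hnorm (T x)"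
    using below by (auto simp: bounded_below_on_def)
  define B where "B x = T' (T x)" for x
  have B: "bounded_module_map B"
    unfolding B_def[abs_def] by (rule bounded_module_map_compose[OF T' T])
  have xB: "hinner x (B x) = hinner (T x) (T x)" if "x \<in> HA" for x
    using that by (simp add: B_def adj map_HA[OF T])
  have Bx: "hinner (B x) x = hinner (T x) (T x)" if "x \<in> HA" for x
    using arg_cong[OF xB[OF that], of star] that
    by (simp add: star_hinner map_HA[OF B] map_HA[OF T])
  have B_below: "c\<^sup>2 * hnorm x \<le> hnorm (B x)" if x: "x \<in> HA" for x
  proof (cases "hnorm x = 0")
    case False
    have "hnorm x * (c\<^sup>2 * hnorm x) = (c * hnorm x)\<^sup>2" by (simp add: power2_eq_square)
    also have "\<dots> \<le> (hnorm (T x))\<^sup>2" using c x by (intro power_mono) auto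
    also have "\<dots> = norm (hinner x (B x))" using x by (simp add: hnorm_square xB)
    also have "\<dots> \<le> hnorm x * hnorm (B x)" by (intro hinner_Cauchy_Schwarz x map_HA[OF B])
    finally show ?thesis using False hnorm_nonneg[of x] by (simp add: mult_le_cancel_left)
  qed simp
  have Bt_below: "c\<^sup>2 * hnorm x \<le> hnorm (B x + x \<cdot>\<^sub>A (t *\<^sub>R 1))" if x: "x \<in> HA" and t: "0 \<le> t" for x t
  proof -
    let ?y = "x \<cdot>\<^sub>A (t *\<^sub>R 1)"
    note HA = map_HA[OF B x] map_HA[OF T x] HA_rmult[OF x, of "t *\<^sub>R 1"]
    have "hinner (B x + ?y) (B x + ?y) - hinner (B x) (B x)
        = t *\<^sub>R hinner (T x) (T x) + t *\<^sub>R hinner (T x) (T x) + (t * t) *\<^sub>R hinner x x"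
      using x HA by (simp add: hinner_add_left hinner_add_right HA_add hinner_rmult_left
          hinner_rmult_right star_scaleR xB Bx scaleR_add_right)
    also have "positive \<dots>"
      using t HA x by (intro positive_add positive_scaleR positive_hinner) auto
    finally have "norm (hinner (B x) (B x)) \<le> norm (hinner (B x + ?y) (B x + ?y))"
      by (intro positive_norm_mono positive_hinner HA)
    then have "hnorm (B x) \<le> hnorm (B x + ?y)" by (simp add: hnorm_def)
    then show ?thesis using B_below[OF x] by simp
  qed
  have "surj (\<lambda>z. Hm (B (seq_of z)))"
  proof (rule surj_of_bounded_below_translates)
    obtain K where K: "\<And>x. x \<in> HA \<Longrightarrow> hnorm (B x) \<le> K * hnorm x"
      using map_bounded[OF B] by blast
    show "bounded_linear (\<lambda>z. Hm (B (seq_of z)))"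
    proof (rule bounded_linear_intro)
      show "Hm (B (seq_of (x + y))) = Hm (B (seq_of x)) + Hm (B (seq_of y))" for x y :: "'a hmodule"
        by (simp add: plus_hmodule.rep_eq Hm_inverse map_add[OF B] map_HA[OF B] HA_add
            flip: seq_of_inject)
      show "Hm (B (seq_of (r *\<^sub>R x))) = r *\<^sub>R Hm (B (seq_of x))" for x :: "'a hmodule" and r
        by (simp add: scaleR_hmodule.rep_eq Hm_inverse map_rmult[OF B] map_HA[OF B] HA_rmult
            flip: seq_of_inject)
      show "norm (Hm (B (seq_of x))) \<le> norm x * K" for x :: "'a hmodule"
        using K[of "seq_of x"] by (simp add: norm_hmodule.rep_eq Hm_inverse map_HA[OF B] mult.commute)
    qed
    show "0 < c\<^sup>2" using c by simp
    show "c\<^sup>2 * norm x \<le> norm (Hm (B (seq_of x)) + t *\<^sub>R x)" if "0 \<le> t" for t and x :: "'a hmodule"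
      using Bt_below[OF _ that, of "seq_of x"]
      by (simp add: norm_hmodule.rep_eq plus_hmodule.rep_eq scaleR_hmodule.rep_eq Hm_inverse map_HA[OF B])
  qed
  then have surj: "\<exists>x\<in>HA. B x = y" if "y \<in> HA" for y
  proof -
    obtain z where "Hm y = Hm (B (seq_of z))" using \<open>surj _\<close> by (meson surjD)
    then have "B (seq_of z) = y" using that by (simp add: Hm_inject map_HA[OF B])
    then show ?thesis by (intro bexI[of _ "seq_of z"]) simp_all
  qed
  have inj: "inj_on B HA"
  proof (rule inj_onI)
    fix x y assume xy: "x \<in> HA" "y \<in> HA" "B x = B y"
    then have "c\<^sup>2 * hnorm (x - y) \<le> 0"
      using B_below[of "x - y"] by (simp add: map_diff[OF B] HA_diff)
    then have "hnorm (x - y) = 0"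
      using c hnorm_nonneg[of "x - y"] by (simp add: mult_le_0_iff)
    then show "x = y" using xy by (simp add: hnorm_eq_zero_iff HA_diff)
  qed
  define L where "L y = inv_into HA B (T' y)" for y
  have img: "B ` HA = HA" using surj map_HA[OF B] by blast
  have L_HA: "L y \<in> HA" and BL: "B (L y) = T' y" if "y \<in> HA" for y
    using that img T'_HA[of y] by (auto simp: L_def inv_into_into f_inv_into_f)
  have L_eq: "L y = x" if "y \<in> HA" "x \<in> HA" "B x = T' y" for x y
    using inj_onD[OF inj, of "L y" x] that L_HA BL by simp
  have "bounded_module_map L"
    unfolding bounded_module_map_def
  proof (intro conjI)
    show "L ` HA \<subseteq> HA" using L_HA by blast
    show "A_linear_on HA L"
      by (auto simp: A_linear_on_def L_HA BL HA_add HA_rmult map_add[OF B] map_add[OF T']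
          map_rmult[OF B] map_rmult[OF T'] intro!: L_eq)
    obtain K where K: "\<And>y. y \<in> HA \<Longrightarrow> hnorm (T' y) \<le> K * hnorm y"
      using map_bounded[OF T'] by blast
    have "hnorm (L y) \<le> (K / c\<^sup>2) * hnorm y" if "y \<in> HA" for y
      using B_below[OF L_HA[OF that]] K[OF that] c(1) by (simp add: BL that field_simps)
    then show "hbounded_on HA L" unfolding hbounded_on_def by blast
  qed
  moreover have "L (T x) = x" if "x \<in> HA" for x
    using that by (intro L_eq map_HA[OF T]) (simp_all add: B_def)
  ultimately show thesis by (rule that)
qed

section \<open>Upper semi-Fredholm operators and compressions\<close>

text \<open>For \<open>x = m + n\<close> in \<open>N\<close> the three constants \<open>C3\<close>, \<open>C1\<close>, \<open>C2\<close> below bound \<open>x\<close> by \<open>m\<close>, \<open>m\<close> by \<open>G m\<close>, and \<open>G m\<close>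
by \<open>P (G x)\<close>, respectively.\<close>

lemma MPhi_hat_imp_bounded_below:
  assumes "G \<in> MPhi_hat_plus_minus"
  shows "\<exists>P\<in>Pa. bounded_below_on (range_of P) (P \<circ> G)"
proof -
  obtain M1 N1 M2 N2 N2' N where G: "G \<in> Ba"
    and d1: "decomposition M1 N1" and d2: "decomposition M2 N2"
    and GN1: "G ` N1 \<subseteq> N2" and iso: "is_iso M1 M2 G" and fg: "finitely_generated N1"
    and sub: "N2' \<subseteq> N2" and isoN: "N2' \<cong>\<^sub>A N1" and d3: "decomposition N N1" and d4: "decomposition N N2'"
    and P_Ba: "proj_along N N2' \<in> Ba"
    using assms by (auto simp: MPhi_hat_plus_minus_def)
  note Gm = Ba_bounded_module_map[OF G]
  define P where "P = proj_along N N2'"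
  have P_eq: "P (m + n) = m" if "m \<in> N" "n \<in> N2'" for m n
    using proj_along_eq[OF d4 that] by (simp add: P_def)
  have sm: "closed_submodule M1" "closed_submodule N1" "closed_submodule M2" "closed_submodule N2"
    "closed_submodule N" "closed_submodule N2'"
    using d1 d2 d4 by (auto simp: decomposition_def)
  have HA: "M \<subseteq> HA" "0 \<in> M" if "closed_submodule M" for M
    using that by (auto simp: closed_submodule_def)
  have P_N: "P x = x" if "x \<in> N" for x
    using P_eq[OF that HA(2)[OF sm(6)]] by simp
  have P_in: "P x \<in> N" "x - P x \<in> N2'" if "x \<in> HA" for x
  proof -
    obtain m n where "m \<in> N" "n \<in> N2'" "x = m + n" using decompositionE[OF d4 \<open>x \<in> HA\<close>] by blast
    then show "P x \<in> N" "x - P x \<in> N2'" using P_eq by simp_all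
  qed
  have range: "range_of P = N"
    using P_in P_N HA(1)[OF sm(5)] by (force simp: range_of_def)
  have kernel: "kernel_of P = N2'"
  proof (intro equalityI subsetI)
    show "x \<in> N2'" if "x \<in> kernel_of P" for x
      using P_in(2)[of x] that by (simp add: kernel_of_def)
    show "x \<in> kernel_of P" if "x \<in> N2'" for x
      using P_eq[OF HA(2)[OF sm(5)] that] HA(1)[OF sm(6)] that by (auto simp: kernel_of_def)
  qed
  have "finitely_generated N2'"
  proof -
    obtain T where T: "bij_betw T N2' N1" "A_linear_on N2' T"
      using isoN by (auto simp: isomorphic_def is_iso_def)
    have "finitely_generated (inv_into N2' T ` N1)"
      using bij_betw_inv_into[OF T(1)]
      by (intro finitely_generated_image fg sm A_linear_on_inv_into[OF sm(6) T(2,1)])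
        (simp add: bij_betw_def)
    then show ?thesis using bij_betw_inv_into[OF T(1)] by (simp add: bij_betw_def)
  qed
  then have Pa: "P \<in> Pa"
    using P_Ba P_N P_in by (simp add: Pa_def kernel) (simp add: P_def)
  obtain C1 where C1: "0 < C1" "\<And>y. y \<in> M2 \<Longrightarrow> hnorm (inv_into M1 G y) \<le> C1 * hnorm y"
    using iso hbounded_onE[of M2 "inv_into M1 G"] by (auto simp: is_iso_def)
  obtain C2 where C2: "0 < C2" "\<And>m n. m \<in> M2 \<Longrightarrow> n \<in> N2 \<Longrightarrow> hnorm m \<le> C2 * hnorm (m + n)"
    using decomposition_bounded[OF d2] by blast
  obtain C3 where C3: "0 < C3" "\<And>m n. m \<in> N \<Longrightarrow> n \<in> N1 \<Longrightarrow> hnorm m \<le> C3 * hnorm (m + n)"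
    using decomposition_bounded[OF d3] by blast
  have bij: "bij_betw G M1 M2" using iso by (simp add: is_iso_def)
  have "hnorm x \<le> C3 * (C1 * (C2 * hnorm (P (G x))))" if x: "x \<in> N" for x
  proof -
    have xHA: "x \<in> HA" using x HA(1)[OF sm(5)] by blast
    obtain m n where mn: "m \<in> M1" "n \<in> N1" "x = m + n" using decompositionE[OF d1 xHA] by blast
    have mnHA: "m \<in> HA" "n \<in> HA" using mn HA(1)[OF sm(1)] HA(1)[OF sm(2)] by auto
    have Gm_M2: "G m \<in> M2" using bij mn by (auto simp: bij_betw_def)
    \<comment> \<open>Thus \<open>P (G x)\<close> is \<open>G m\<close> plus a vector of \<open>N2\<close>.\<close>
    have "G n - (G x - P (G x)) \<in> N2"
      using closed_submodule_diff[OF sm(4)] GN1 mn(2) P_in(2)[OF map_HA[OF Gm xHA]] sub by blast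
    from C2(2)[OF Gm_M2 this] have Gm_le: "hnorm (G m) \<le> C2 * hnorm (P (G x))"
      by (simp add: mn(3) map_add[OF Gm] mnHA algebra_simps)
    have "hnorm m \<le> C1 * hnorm (G m)"
      using C1(2)[OF Gm_M2] bij mn(1) by (simp add: bij_betw_def)
    also have "\<dots> \<le> C1 * (C2 * hnorm (P (G x)))"
      using Gm_le C1 by (intro mult_left_mono) auto
    finally have m_le: "hnorm m \<le> C1 * (C2 * hnorm (P (G x)))" .
    \<comment> \<open>The vector \<open>m = x - n\<close> splits as \<open>x \<in> N\<close> plus \<open>- n \<in> N1\<close>.\<close>
    have "hnorm x \<le> C3 * hnorm (x + - n)"
      by (rule C3(2)[OF x closed_submodule_minus[OF sm(2) mn(2)]])
    also have "x + - n = m" by (simp add: mn(3))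
    also have "C3 * hnorm m \<le> C3 * (C1 * (C2 * hnorm (P (G x))))"
      using m_le C3 by (intro mult_left_mono) auto
    finally show ?thesis .
  qed
  then have "bounded_below_on N (P \<circ> G)"
    unfolding bounded_below_on_def using C1 C2 C3
    by (intro exI[of _ "1 / (C3 * C1 * C2)"]) (auto simp: field_simps)
  then show ?thesis using Pa range by auto
qed

text \<open>Everything is read off from the map \<open>E\<close>, which inverts \<open>G\<close> on the range of \<open>P\<close> and vanishes on the kernel
of \<open>P\<close>. Both \<open>N2'\<close> and the common complement \<open>N\<close> in the definition of the class come from \<open>P\<close> itself:
its kernel and its range.\<close>

lemma bounded_below_imp_MPhi_hat:
  fixes G P :: "(nat \<Rightarrow> 'a::cstar_algebra) \<Rightarrow> nat \<Rightarrow> 'a"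
  assumes G: "G \<in> Ba" and P: "P \<in> Pa" and below: "bounded_below_on (range_of P) (P \<circ> G)"
  shows "G \<in> MPhi_hat_plus_minus"
proof -
  have P_Ba: "P \<in> Ba" and PP: "\<And>x. x \<in> HA \<Longrightarrow> P (P x) = P x" and fg: "finitely_generated (kernel_of P)"
    using P by (auto simp: Pa_def)
  note Gm = Ba_bounded_module_map[OF G] and Pm = Ba_bounded_module_map[OF P_Ba]
  obtain c where c: "0 < c" "\<And>x. x \<in> HA \<Longrightarrow> c * hnorm (P x) \<le> hnorm (P (G (P x)))"
    using below by (auto simp: bounded_below_on_def range_of_def)
  \<comment> \<open>Adding \<open>1 - P\<close> makes the compression of \<open>G\<close> bounded below on the whole module.\<close>
  define T where "T x = P (G (P x)) + (x - P x)" for x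
  have T_Ba: "T \<in> Ba"
    unfolding T_def[abs_def]
    by (rule Ba_add[OF Ba_compose[OF P_Ba Ba_compose[OF G P_Ba]] Ba_diff[OF Ba_id P_Ba]])
  note Tm = Ba_bounded_module_map[OF T_Ba]
  note HA = map_HA[OF Gm] map_HA[OF Pm] map_HA[OF Tm] HA_add HA_diff
  obtain K where K: "0 < K" "\<And>x. x \<in> HA \<Longrightarrow> hnorm (P x) \<le> K * hnorm x"
    using map_bounded[OF Pm] by blast
  have "hnorm x \<le> (K / c + (1 + K)) * hnorm (T x)" if x: "x \<in> HA" for x
  proof -
    have PT: "P (T x) = P (G (P x))"
      using x by (simp add: T_def map_add[OF Pm] map_diff[OF Pm] PP HA)
    have 1: "c * hnorm (P x) \<le> K * hnorm (T x)"
      using c(2)[OF x] K(2)[OF HA(3)[OF x]] by (simp add: PT)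
    have "x - P x = T x - P (T x)" by (simp add: PT) (simp add: T_def)
    then have "hnorm (x - P x) \<le> hnorm (T x) + hnorm (P (T x))"
      using x by (simp add: hnorm_triangle_diff HA)
    then have 2: "hnorm (x - P x) \<le> (1 + K) * hnorm (T x)"
      using K(2)[OF HA(3)[OF x]] by (simp add: distrib_right)
    have "hnorm (P x + (x - P x)) \<le> hnorm (P x) + hnorm (x - P x)"
      using x by (intro hnorm_triangle HA)
    moreover have "hnorm (P x) \<le> K / c * hnorm (T x)" using 1 c by (simp add: field_simps)
    ultimately show ?thesis using 2 by (simp add: distrib_right)
  qed
  moreover have "0 < K / c + (1 + K)" using K c by (simp add: add_pos_pos)
  ultimately have "bounded_below_on HA T"
    unfolding bounded_below_on_def
    by (intro exI[of _ "1 / (K / c + (1 + K))"]) (simp add: divide_le_eq mult.commute)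
  then obtain L where Lm: "bounded_module_map L" and LT: "\<And>x. x \<in> HA \<Longrightarrow> L (T x) = x"
    using bounded_below_left_inverse[OF T_Ba] by blast
  define E where "E y = P (L (P y))" for y
  have Em: "bounded_module_map E"
    unfolding E_def[abs_def]
    by (rule bounded_module_map_compose[OF Pm bounded_module_map_compose[OF Lm Pm]])
  note HA = HA map_HA[OF Em] map_HA[OF Lm]
  have E_range: "E y \<in> range_of P" if "y \<in> HA" for y
    using that by (simp add: E_def range_of_def HA)
  have P_range: "P x = x" "x \<in> HA" if "x \<in> range_of P" for x
    using that PP HA by (auto simp: range_of_def)
  have EG: "E (G x) = x" if "x \<in> range_of P" for x
    using LT[OF P_range(2)[OF that]] P_range[OF that] by (simp add: E_def T_def)
  have EP: "E y = 0" if "y \<in> kernel_of P" for y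
    using that by (simp add: E_def kernel_of_def map_zero[OF Lm] map_zero[OF Pm])
  have EGm: "bounded_module_map (\<lambda>x. E (G x))" and GEm: "bounded_module_map (\<lambda>x. G (E x))"
    by (rule bounded_module_map_compose[OF Em Gm] bounded_module_map_compose[OF Gm Em])+
  define N1 where "N1 = kernel_of (\<lambda>x. E (G x))"
  define M2 where "M2 = (\<lambda>y. G (E y)) ` HA"
  define N2 where "N2 = kernel_of (\<lambda>y. G (E y))"
  have EG_range: "range_of P = (\<lambda>x. E (G x)) ` HA"
  proof (intro equalityI subsetI)
    show "x \<in> (\<lambda>x. E (G x)) ` HA" if "x \<in> range_of P" for x
      using EG[OF that] P_range(2)[OF that] by (metis imageI)
  qed (auto simp: E_range HA)
  have d1: "decomposition (range_of P) N1"
    unfolding N1_def EG_range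
    by (rule decomposition_idempotent[OF EGm]) (simp add: EG E_range HA)
  have d2: "decomposition M2 N2"
    unfolding M2_def N2_def by (rule decomposition_idempotent[OF GEm]) (simp add: EG E_range HA)
  have dP: "decomposition (range_of P) (kernel_of P)"
    unfolding range_of_def by (rule decomposition_idempotent[OF Pm PP])
  have inj: "inj_on G (range_of P)" by (rule inj_on_inverseI) (rule EG)
  have GM: "G ` range_of P = M2"
  proof (intro equalityI subsetI)
    fix y assume "y \<in> G ` range_of P"
    then obtain x where x: "x \<in> range_of P" "y = G x" by blast
    then have "y = G (E (G x))" "G x \<in> HA" by (simp_all add: EG P_range HA)
    then show "y \<in> M2" unfolding M2_def by blast
  qed (auto simp: M2_def E_range)
  have iso: "is_iso (range_of P) M2 G"
    unfolding is_iso_def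
  proof (intro conjI)
    show "bij_betw G (range_of P) M2" using inj GM by (simp add: bij_betw_def)
    show "A_linear_on (range_of P) G"
      by (simp add: A_linear_on_def map_add[OF Gm] map_rmult[OF Gm] P_range)
    show "hbounded_on (range_of P) G"
      using map_bounded[OF Gm] P_range(2) unfolding hbounded_on_def by metis
    obtain K where "\<And>y. y \<in> HA \<Longrightarrow> hnorm (E y) \<le> K * hnorm y" using map_bounded[OF Em] by blast
    then have "hnorm (inv_into (range_of P) G (G x)) \<le> K * hnorm (G x)" if "x \<in> range_of P" for x
      using that by (metis EG HA(1) P_range(2) inj inv_into_f_f)
    then show "hbounded_on M2 (inv_into (range_of P) G)"
      unfolding hbounded_on_def GM[symmetric] by blast
  qed
  \<comment> \<open>The kernels of \<open>P\<close> and of \<open>E G\<close> are both complements of the range of \<open>P\<close>; \<open>J\<close> maps the first to the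
    second along that range, with inverse \<open>x \<mapsto> x - P x\<close>.\<close>
  define J where "J n = n - E (G n)" for n
  have Jm: "bounded_module_map J"
    unfolding J_def[abs_def] by (rule bounded_module_map_diff[OF bounded_module_map_id EGm])
  have JP: "J n - P (J n) = n" if n: "n \<in> kernel_of P" for n
  proof -
    have "n \<in> HA" "P n = 0" using n by (auto simp: kernel_of_def)
    then show ?thesis by (simp add: J_def map_diff[OF Pm] HA P_range E_range)
  qed
  have J_inj: "inj_on J (kernel_of P)"
    by (rule inj_on_inverseI[where g = "\<lambda>x. x - P x"]) (rule JP)
  have J_img: "J ` kernel_of P = N1"
  proof (intro equalityI subsetI)
    fix x assume "x \<in> J ` kernel_of P"
    then show "x \<in> N1"
      by (auto simp: N1_def J_def kernel_of_def HA map_diff[OF EGm] EG E_range)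
  next
    fix x assume "x \<in> N1"
    then have x: "x \<in> HA" "E (G x) = 0" by (auto simp: N1_def kernel_of_def)
    have "P x \<in> range_of P" using x by (simp add: range_of_def)
    then have "J (x - P x) = x"
      using x by (simp add: J_def map_diff[OF EGm] HA EG)
    moreover have "x - P x \<in> kernel_of P" using x by (simp add: kernel_of_def HA map_diff[OF Pm] PP)
    ultimately show "x \<in> J ` kernel_of P" by (metis imageI)
  qed
  have J_lin: "A_linear_on (kernel_of P) J"
    by (auto simp: A_linear_on_def map_add[OF Jm] map_rmult[OF Jm] kernel_of_def)
  have isoN: "kernel_of P \<cong>\<^sub>A N1"
    unfolding isomorphic_def is_iso_def
  proof (intro exI[of _ J] conjI J_lin)
    show "bij_betw J (kernel_of P) N1" using J_inj J_img by (simp add: bij_betw_def)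
    obtain K where "\<And>x. x \<in> HA \<Longrightarrow> hnorm (J x) \<le> K * hnorm x" using map_bounded[OF Jm] by blast
    then show "hbounded_on (kernel_of P) J" by (auto simp: hbounded_on_def kernel_of_def)
    have "bounded_module_map (\<lambda>x. x - P x)"
      by (rule bounded_module_map_diff[OF bounded_module_map_id Pm])
    then obtain K where K: "\<And>x. x \<in> HA \<Longrightarrow> hnorm (x - P x) \<le> K * hnorm x" using map_bounded by blast
    have "hnorm (inv_into (kernel_of P) J (J n)) \<le> K * hnorm (J n)" if n: "n \<in> kernel_of P" for n
    proof -
      have "J n \<in> HA" using n by (simp add: kernel_of_def map_HA[OF Jm])
      from K[OF this] show ?thesis by (simp add: JP n inv_into_f_f[OF J_inj])
    qed
    then show "hbounded_on N1 (inv_into (kernel_of P) J)"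
      unfolding hbounded_on_def J_img[symmetric] by blast
  qed
  have fgN1: "finitely_generated N1"
    unfolding J_img[symmetric]
    by (rule finitely_generated_image[OF closed_submodule_kernel[OF Pm] fg J_lin J_inj])
  have GN1: "G ` N1 \<subseteq> N2"
    by (auto simp: N1_def N2_def kernel_of_def HA map_zero[OF Gm])
  have sub: "kernel_of P \<subseteq> N2"
    by (auto simp: N2_def EP map_zero[OF Gm]) (simp add: kernel_of_def EP map_zero[OF Gm])
  have proj: "proj_along (range_of P) (kernel_of P) \<in> Ba"
  proof (rule Ba_cong[OF P_Ba])
    fix x :: "nat \<Rightarrow> 'a" assume x: "x \<in> HA"
    have "proj_along (range_of P) (kernel_of P) (P x + (x - P x)) = P x"
      using x by (intro proj_along_eq[OF dP])
        (simp_all add: range_of_def kernel_of_def HA map_diff[OF Pm] PP)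
    then show "proj_along (range_of P) (kernel_of P) x = P x" by simp
  qed
  have closed: "closed_submodule (range_of P)" "closed_submodule (kernel_of P)"
    using dP by (auto simp: decomposition_def)
  show ?thesis
    unfolding MPhi_hat_plus_minus_def
    by (intro CollectI conjI exI[of _ "range_of P"] exI[of _ N1] exI[of _ M2] exI[of _ N2]
        exI[of _ "kernel_of P"] G d1 d2 GN1 iso fgN1 closed sub isoN dP proj equalityD1[OF GM])
qed

theorem theorem3p5:
  fixes F :: "(nat \<Rightarrow> 'a::cstar_algebra) \<Rightarrow> (nat \<Rightarrow> 'a)"
  assumes "F \<in> Ba"
  shows "sigma_ea F = (\<Inter>P\<in>Pa. sigma_a (range_of P) (P \<circ> F))"
proof -
  have eq: "\<alpha> \<in> sigma_ea F \<longleftrightarrow> (\<forall>P\<in>Pa. \<alpha> \<in> sigma_a (range_of P) (P \<circ> F))" if \<alpha>: "\<alpha> \<in> center" for \<alpha>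
  proof -
    define G where "G x = F x - x \<cdot>\<^sub>A \<alpha>" for x
    have G: "G \<in> Ba" unfolding G_def[abs_def] by (rule Ba_diff[OF assms Ba_rmult_central[OF \<alpha>]])
    have "bounded_below_on (range_of P) (\<lambda>x. (P \<circ> F) x - x \<cdot>\<^sub>A \<alpha>) \<longleftrightarrow> bounded_below_on (range_of P) (P \<circ> G)"
      if P: "P \<in> Pa" for P
    proof -
      have Pm: "bounded_module_map P" and PP: "\<And>x. x \<in> HA \<Longrightarrow> P (P x) = P x"
        using P Ba_bounded_module_map by (auto simp: Pa_def)
      have "(P \<circ> F) x - x \<cdot>\<^sub>A \<alpha> = (P \<circ> G) x" if "x \<in> range_of P" for x
      proof -
        have "P x = x" "x \<in> HA" using that PP map_HA[OF Pm] by (auto simp: range_of_def)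
        then show ?thesis
          by (simp add: G_def map_diff[OF Pm] map_rmult[OF Pm] HA_rmult
              map_HA[OF Ba_bounded_module_map[OF assms]])
      qed
      then show ?thesis by (simp add: bounded_below_on_def)
    qed
    moreover have "G \<in> MPhi_hat_plus_minus \<longleftrightarrow> (\<exists>P\<in>Pa. bounded_below_on (range_of P) (P \<circ> G))"
      using MPhi_hat_imp_bounded_below bounded_below_imp_MPhi_hat[OF G] by blast
    ultimately show ?thesis
      using \<alpha> by (auto simp: sigma_ea_def sigma_a_def G_def[abs_def])
  qed
  \<comment> \<open>The identity shows that the intersection is over a nonempty family, so it stays within the center.\<close>
  have "(\<lambda>x. x) \<in> (Pa :: ((nat \<Rightarrow> 'a) \<Rightarrow> nat \<Rightarrow> 'a) set)"
  proof -
    have "kernel_of (\<lambda>x. x) = {0 :: nat \<Rightarrow> 'a}" by (auto simp: kernel_of_def)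
    moreover have "finitely_generated {0 :: nat \<Rightarrow> 'a}"
      by (auto simp: finitely_generated_def intro!: exI[of _ "{}"])
    ultimately show ?thesis by (simp add: Pa_def Ba_id)
  qed
  then have "(\<Inter>P\<in>Pa. sigma_a (range_of P) (P \<circ> F)) \<subseteq> center"
    by (auto simp: sigma_a_def)
  moreover have "sigma_ea F \<subseteq> center" by (auto simp: sigma_ea_def)
  ultimately show ?thesis using eq by blast
qed

end
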